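(* Let $A$ be an abelian group. The following are equivalent. (1) $A$ is cotorsion. (2) $A$ is a homomorphic image of $(\prod_{i \in \omega} G_i)/(\bigoplus_{i \in \omega} G_i)$ for some sequence $(G_i)_{i \in \omega}$ of groups which are not necessarily abelian. (3) $A$ is a homomorphic image of a product of (an arbitrary family of) finite cyclic groups. (4) $A$ is a homomorphic image of a product $\prod_{j \in J} F_j$, for some index set $J$, where each $F_j$ is a finite group which is not necessarily abelian.
   Context: $\omega$ is the set of natural numbers (including $0$). An abelian group $A$ is cotorsion if every short exact sequence of abelian groups $0 \to A \to B \to C \to 0$ with $C$ torsion-free splits. For a sequence of (possibly nonabelian) groups, $\prod_{i\in\omega} G_i$ is the full direct product and $\bigoplus_{i\in\omega} G_i$ is its normal subgroup of elements that are trivial in all but finitely many coordinates. "Homomorphic image" means image under a surjective group homomorphism. *)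

theory Defs
  imports "HOL-Algebra.Product_Groups"
begin

text \<open>
  Groups are written multiplicatively throughout, also the abelian ones.

  The notions below quantify over groups of unrestricted size. A HOL formula cannot quantify over
  types, so each notion takes as \<open>itself\<close> arguments the types in which the quantified groups and
  index sets live. The theorem states the equivalences for fixed types built from the type of \<open>A\<close>
  and, for arbitrary other types, that nothing is lost by that choice: a universal notion for
  the fixed types implies the notion for any types, and an existential notion for any
  types implies it for the fixed types.
\<close>

definition torsion_free_group :: "('c, 'm) monoid_scheme \<Rightarrow> bool" where
  "torsion_free_group C \<longleftrightarrow>
     group C \<and> (\<forall>x \<in> carrier C. \<forall>n::nat. n > 0 \<longrightarrow> x [^]\<^bsub>C\<^esub> n = \<one>\<^bsub>C\<^esub> \<longrightarrow> x = \<one>\<^bsub>C\<^esub>)"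

text \<open>
  The library relation \<open>exact_seq\<close> forces all groups of a sequence to have the same element type,
  hence the following definition for three types.
\<close>

definition short_exact ::
  "'a monoid \<Rightarrow> ('a \<Rightarrow> 'b) \<Rightarrow> 'b monoid \<Rightarrow> ('b \<Rightarrow> 'c) \<Rightarrow> 'c monoid \<Rightarrow> bool" where
  "short_exact A i B p C \<longleftrightarrow>
     i \<in> mon A B \<and> p \<in> epi B C \<and> i ` carrier A = kernel B C p"

definition splits :: "'b monoid \<Rightarrow> ('b \<Rightarrow> 'c) \<Rightarrow> 'c monoid \<Rightarrow> bool" where
  "splits B p C \<longleftrightarrow> (\<exists>s \<in> hom C B. \<forall>c \<in> carrier C. p (s c) = c)"

definition cotorsion :: "'b itself \<Rightarrow> 'c itself \<Rightarrow> 'a monoid \<Rightarrow> bool" where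
  "cotorsion _ _ A \<longleftrightarrow>
     comm_group A \<and>
     (\<forall>(B :: 'b monoid) (C :: 'c monoid) i p.
        comm_group B \<and> comm_group C \<and> torsion_free_group C \<and> short_exact A i B p C
        \<longrightarrow> splits B p C)"

definition homomorphic_image :: "'h monoid \<Rightarrow> 'a monoid \<Rightarrow> bool" where
  "homomorphic_image H A \<longleftrightarrow> (\<exists>f. f \<in> epi H A)"

definition reduced_product :: "(nat \<Rightarrow> 'g monoid) \<Rightarrow> (nat \<Rightarrow> 'g) set monoid" where
  "reduced_product G = product_group UNIV G Mod carrier (sum_group UNIV G)"

definition image_of_reduced_product :: "'g itself \<Rightarrow> 'a monoid \<Rightarrow> bool" where
  "image_of_reduced_product _ A \<longleftrightarrow>
     (\<exists>G :: nat \<Rightarrow> 'g monoid.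
        (\<forall>i. group (G i)) \<and> homomorphic_image (reduced_product G) A)"

definition image_of_product_of_finite_cyclic_groups ::
  "'j itself \<Rightarrow> 'f itself \<Rightarrow> 'a monoid \<Rightarrow> bool" where
  "image_of_product_of_finite_cyclic_groups _ _ A \<longleftrightarrow>
     (\<exists>(J :: 'j set) (F :: 'j \<Rightarrow> 'f monoid).
        (\<forall>j \<in> J. group (F j) \<and> finite (carrier (F j)) \<and> cyclic_group (F j)) \<and>
        homomorphic_image (product_group J F) A)"

definition image_of_product_of_finite_groups ::
  "'j itself \<Rightarrow> 'f itself \<Rightarrow> 'a monoid \<Rightarrow> bool" where
  "image_of_product_of_finite_groups _ _ A \<longleftrightarrow>
     (\<exists>(J :: 'j set) (F :: 'j \<Rightarrow> 'f monoid).
        (\<forall>j \<in> J. group (F j) \<and> finite (carrier (F j))) \<and>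
        homomorphic_image (product_group J F) A)"

text \<open>
  The fixed type for the middle and right-hand groups of a short exact sequence. It is large enough
  to contain the cosets in a product, indexed by \<open>'a \<times> nat\<close>, of cyclic groups.
\<close>

type_synonym 'a ext = "('a \<times> nat \<Rightarrow> int) set"

end

theory Submission
  imports Defs "HOL-Algebra.Free_Abelian_Groups"
begin

text \<open>
  Everything goes through one property of a group, which makes sense without commutativity: for all
  \<open>a\<^sub>0, a\<^sub>1, \<dots>\<close> and integers \<open>d\<^sub>0, d\<^sub>1, \<dots>\<close> the system \<open>x\<^sub>n = a\<^sub>n x\<^sub>n\<^sub>+\<^sub>1 ^ d\<^sub>n\<close> has a solution. Finite groups have
  it by compactness, products and homomorphic images inherit it, and in a quotient of a product by the
  sum the system is solved coordinatewise by downward recursion.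

  An abelian group \<open>A\<close> with this property is cotorsion: by Zorn's lemma the identity of \<open>A\<close> extends to a
  retraction of any extension by a torsion-free group, because each extension step concerns a
  torsion-free group of rank one, that is, an ascending union of infinite cyclic groups.

  Conversely, let \<open>P\<close> be the product of \<open>\<int>/(n+1)\<close> over all \<open>(a, n) \<in> A \<times> \<omega>\<close>, \<open>T\<close> its torsion subgroup,
  \<open>F \<le> P\<close> the diagonally embedded free abelian group on \<open>A\<close>, and \<open>K\<close> the kernel of \<open>F \<rightarrow> A\<close>. Then
  \<open>T \<inter> F\<close> is trivial and \<open>P / (T F)\<close> is torsion-free, so a cotorsion \<open>A \<cong> T F / T K\<close> is a direct summand
  of \<open>P / T K\<close>. The resulting surjection \<open>P \<rightarrow> A\<close> kills all torsion, in particular the elements that are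
  trivial for all but finitely many \<open>n\<close>, so it also factors through a reduced product.
\<close>

section \<open>Solvable sequential systems\<close>

lemma decreasing_finite_sets_Inter_nonempty:
  fixes Z :: "nat \<Rightarrow> 'a set"
  assumes fin: "finite (Z 0)" and ne: "\<And>k. Z k \<noteq> {}" and dec: "\<And>k. Z (Suc k) \<subseteq> Z k"
  shows "(\<Inter>k. Z k) \<noteq> {}"
proof
  assume empty: "(\<Inter>k. Z k) = {}"
  have anti: "Z m \<subseteq> Z k" if "k \<le> m" for k m
    using lift_Suc_antimono_le[of Z, OF dec that] .
  obtain K where K: "\<And>z. z \<in> Z 0 \<Longrightarrow> z \<notin> Z (K z)"
    using empty by (metis INT_I UNIV_I empty_iff)
  \<comment> \<open>Each \<open>z\<close> of \<open>Z 0\<close> is missing from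
    \<open>Z (K z)\<close>, so by stage \<open>m\<close> the finite set \<open>Z 0\<close> would be
    exhausted.\<close>
  define m where "m = Max (K ` Z 0)"
  obtain z where z: "z \<in> Z m" using ne by blast
  then have z0: "z \<in> Z 0" using anti by blast
  then have "K z \<le> m" unfolding m_def using fin by simp
  then show False using K[OF z0] z anti by blast
qed

text \<open>An element of \<open>X n\<close> may lack preimages far up the sequence. Those with
  preimages at every stage form nonempty sets \<open>S n\<close>, and each element of
  \<open>S n\<close> has a preimage in \<open>S (Suc n)\<close>, so dependent choice builds a thread
  upwards from index 0.\<close>

lemma finite_inverse_sequence:
  fixes X :: "nat \<Rightarrow> 'a set" and \<phi> :: "nat \<Rightarrow> 'a \<Rightarrow> 'a"
  assumes fin: "\<And>n. finite (X n)" and ne: "\<And>n. X n \<noteq> {}"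
    and \<phi>: "\<And>n x. x \<in> X (Suc n) \<Longrightarrow> \<phi> n x \<in> X n"
  shows "\<exists>x. \<forall>n. x n \<in> X n \<and> x n = \<phi> n (x (Suc n))"
proof -
  \<comment> \<open>\<open>I k n\<close> is the image of \<open>X (n + k)\<close> in
    \<open>X n\<close> under the composite of \<open>k\<close> maps.\<close>
  define I where "I = rec_nat X (\<lambda>k Y n. \<phi> n ` Y (Suc n))"
  have I0: "I 0 = X" and IS: "I (Suc k) n = \<phi> n ` I k (Suc n)" for k n
    by (simp_all add: I_def)
  have dec: "I (Suc k) n \<subseteq> I k n" for k n
  proof (induction k arbitrary: n)
    case 0 then show ?case using \<phi> by (auto simp: IS I0)
  next
    case (Suc k) then show ?case by (metis IS image_mono)
  qed
  have sub: "I k n \<subseteq> X n" for k n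
    by (induction k) (use dec I0 in auto)
  have Ine: "I k n \<noteq> {}" for k n
    by (induction k arbitrary: n) (auto simp: I0 IS ne)
  define S where "S n = (\<Inter>k. I k n)" for n
  have "S 0 \<noteq> {}"
    unfolding S_def by (rule decreasing_finite_sets_Inter_nonempty) (use fin Ine dec I0 in auto)
  then obtain x0 where x0: "x0 \<in> S 0" by blast
  have step: "\<exists>z. z \<in> S (Suc n) \<and> y = \<phi> n z" if "y \<in> S n" for n y
  proof -
    \<comment> \<open>Since \<open>y\<close> lies in \<open>I (Suc k) n\<close>, it has a preimage
      in each \<open>I k (Suc n)\<close>; compactness of these decreasing preimage sets yields one
      that works for all \<open>k\<close>.\<close>
    have "(\<Inter>k. {z \<in> I k (Suc n). y = \<phi> n z}) \<noteq> {}"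
    proof (rule decreasing_finite_sets_Inter_nonempty)
      show "finite {z \<in> I 0 (Suc n). y = \<phi> n z}" using fin I0 by simp
      show "{z \<in> I k (Suc n). y = \<phi> n z} \<noteq> {}" for k
        using that unfolding S_def using IS[of k n] by blast
      show "{z \<in> I (Suc k) (Suc n). y = \<phi> n z} \<subseteq> {z \<in> I k (Suc n). y = \<phi> n z}" for k
        using dec by blast
    qed
    then show ?thesis unfolding S_def by blast
  qed
  from dependent_nat_choice[of "\<lambda>n y. y \<in> S n" "\<lambda>n y z. y = \<phi> n z"] x0 step
  obtain x where "\<And>n. x n \<in> S n \<and> x n = \<phi> n (x (Suc n))" by blast
  then show ?thesis using I0 unfolding S_def by (metis INT_E UNIV_I)
qed

text \<open>For abelian \<open>G\<close> this is surjectivity of the map from \<open>x\<close> to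
  the sequence \<open>x n \<otimes> inv (x (Suc n) [^] d n)\<close>, that is, vanishing of lim^1 for
  every tower of copies of \<open>G\<close> with power maps as transition maps.\<close>

definition sequentially_solvable :: "('a, 'm) monoid_scheme \<Rightarrow> bool" where
  "sequentially_solvable G \<longleftrightarrow>
     (\<forall>(a :: nat \<Rightarrow> 'a) (d :: nat \<Rightarrow> int). (\<forall>n. a n \<in> carrier G) \<longrightarrow>
        (\<exists>x. \<forall>n. x n \<in> carrier G \<and> x n = a n \<otimes>\<^bsub>G\<^esub> x (Suc n) [^]\<^bsub>G\<^esub> d n))"

lemma sequentially_solvableD:
  assumes "sequentially_solvable G" "\<And>n. a n \<in> carrier G"
  obtains x where "\<And>n. x n \<in> carrier G" "\<And>n. x n = a n \<otimes>\<^bsub>G\<^esub> x (Suc n) [^]\<^bsub>G\<^esub> (d n :: int)"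
proof -
  have "\<exists>x. \<forall>n. x n \<in> carrier G \<and> x n = a n \<otimes>\<^bsub>G\<^esub> x (Suc n) [^]\<^bsub>G\<^esub> d n"
    using assms(1)[unfolded sequentially_solvable_def, rule_format, of a d] assms(2) by blast
  then show thesis using that by blast
qed

text \<open>Solutions are the threads of the inverse sequence with all sets \<open>carrier G\<close>
  and with maps sending \<open>y\<close> to \<open>a n \<otimes> y [^] d n\<close>. Compactness
  applies to arbitrary maps, so these need not be homomorphisms.\<close>

lemma sequentially_solvable_finite:
  assumes "group G" "finite (carrier G)"
  shows "sequentially_solvable G"
  unfolding sequentially_solvable_def
proof (intro allI impI)
  interpret group G by fact
  fix a :: "nat \<Rightarrow> _" and d :: "nat \<Rightarrow> int" assume a: "\<forall>n. a n \<in> carrier G"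
  show "\<exists>x. \<forall>n. x n \<in> carrier G \<and> x n = a n \<otimes>\<^bsub>G\<^esub> x (Suc n) [^]\<^bsub>G\<^esub> d n"
    by (rule finite_inverse_sequence) (use assms(2) a in auto)
qed

section \<open>Solvability in products, homomorphic images and reduced products\<close>

lemma int_pow_product_group:
  assumes "\<And>i. i \<in> I \<Longrightarrow> group (G i)" "x \<in> carrier (product_group I G)" "i \<in> I"
  shows "(x [^]\<^bsub>product_group I G\<^esub> (k::int)) i = x i [^]\<^bsub>G i\<^esub> k"
proof -
  have "(\<lambda>x. x i) \<in> hom (product_group I G) (G i)"
    using assms(3) by (auto simp: hom_def)
  then have "group_hom (product_group I G) (G i) (\<lambda>x. x i)"
    using assms by (simp add: group_hom_def group_hom_axioms_def)
  then show ?thesis using group_hom.hom_int_pow assms(2) by fastforce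
qed

lemma sequentially_solvable_product_group:
  assumes grp: "\<And>i. i \<in> I \<Longrightarrow> group (G i)" and "\<And>i. i \<in> I \<Longrightarrow> sequentially_solvable (G i)"
  shows "sequentially_solvable (product_group I G)"
  unfolding sequentially_solvable_def
proof (intro allI impI)
  let ?P = "product_group I G"
  fix a :: "nat \<Rightarrow> _" and d :: "nat \<Rightarrow> int" assume a: "\<forall>n. a n \<in> carrier ?P"
  have "\<forall>i\<in>I. \<exists>x. \<forall>n. x n \<in> carrier (G i) \<and> x n = a n i \<otimes>\<^bsub>G i\<^esub> x (Suc n) [^]\<^bsub>G i\<^esub> d n"
  proof
    fix i assume i: "i \<in> I"
    then have ai: "\<And>n. a n i \<in> carrier (G i)" using a by (metis PiE_mem carrier_product_group)
    show "\<exists>x. \<forall>n. x n \<in> carrier (G i) \<and> x n = a n i \<otimes>\<^bsub>G i\<^esub> x (Suc n) [^]\<^bsub>G i\<^esub> d n"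
      by (rule sequentially_solvableD[OF assms(2)[OF i], of "\<lambda>n. a n i" d, OF ai]) blast
  qed
  then obtain y where y: "\<And>i n. i \<in> I \<Longrightarrow> y i n \<in> carrier (G i)"
      "\<And>i n. i \<in> I \<Longrightarrow> y i n = a n i \<otimes>\<^bsub>G i\<^esub> y i (Suc n) [^]\<^bsub>G i\<^esub> d n"
    by metis
  define x where "x n = (\<lambda>i\<in>I. y i n)" for n
  have xc: "x n \<in> carrier ?P" for n by (simp add: x_def y(1))
  have "x n = a n \<otimes>\<^bsub>?P\<^esub> x (Suc n) [^]\<^bsub>?P\<^esub> d n" for n
  proof
    fix i
    show "x n i = (a n \<otimes>\<^bsub>?P\<^esub> x (Suc n) [^]\<^bsub>?P\<^esub> d n) i"
    proof (cases "i \<in> I")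
      case True
      then show ?thesis
        using y(2)[OF True, of n] int_pow_product_group[OF grp xc[of "Suc n"] True] by (simp add: x_def)
    qed (simp add: x_def)
  qed
  then show "\<exists>x. \<forall>n. x n \<in> carrier ?P \<and> x n = a n \<otimes>\<^bsub>?P\<^esub> x (Suc n) [^]\<^bsub>?P\<^esub> d n"
    using xc by blast
qed

text \<open>Lift the coefficients to \<open>G\<close> arbitrarily, solve there and apply
  \<open>f\<close>.\<close>

lemma sequentially_solvable_epi:
  assumes "group G" "group A" "f \<in> epi G A" "sequentially_solvable G"
  shows "sequentially_solvable A"
  unfolding sequentially_solvable_def
proof (intro allI impI)
  interpret group_hom G A f
    using assms by (simp add: group_hom_def group_hom_axioms_def epi_def)
  fix a :: "nat \<Rightarrow> _" and d :: "nat \<Rightarrow> int" assume "\<forall>n. a n \<in> carrier A"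
  then have "\<forall>n. \<exists>g. g \<in> carrier G \<and> f g = a n"
    using assms(3) by (metis (mono_tags, lifting) epi_def imageE mem_Collect_eq)
  then obtain g where g: "\<And>n. g n \<in> carrier G" "\<And>n. f (g n) = a n" by metis
  obtain x where x: "\<And>n. x n \<in> carrier G" "\<And>n. x n = g n \<otimes>\<^bsub>G\<^esub> x (Suc n) [^]\<^bsub>G\<^esub> d n"
    by (rule sequentially_solvableD[OF assms(4), of g d, OF g(1)]) blast
  have fx: "f (x n) = a n \<otimes>\<^bsub>A\<^esub> f (x (Suc n)) [^]\<^bsub>A\<^esub> d n" for n
    using arg_cong[OF x(2)[of n], of f] x(1) g by (simp add: hom_int_pow)
  show "\<exists>x. \<forall>n. x n \<in> carrier A \<and> x n = a n \<otimes>\<^bsub>A\<^esub> x (Suc n) [^]\<^bsub>A\<^esub> d n"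
    by (rule exI[of _ "\<lambda>n. f (x n)"]) (intro allI conjI hom_closed x(1) fx)
qed

text \<open>Conjugation acts coordinatewise and fixes the identity, so the support of a conjugate of
  \<open>h\<close> lies in the finite support of \<open>h\<close>.\<close>

lemma sum_group_normal:
  assumes "\<And>i. i \<in> I \<Longrightarrow> group (G i)"
  shows "carrier (sum_group I G) \<lhd> product_group I G"
proof -
  let ?P = "product_group I G"
  interpret P: group ?P using assms by simp
  have "x \<otimes>\<^bsub>?P\<^esub> h \<otimes>\<^bsub>?P\<^esub> inv\<^bsub>?P\<^esub> x \<in> carrier (sum_group I G)"
    if x: "x \<in> carrier ?P" and h: "h \<in> carrier (sum_group I G)" for x h
  proof -
    have hc: "h \<in> carrier ?P" and fin: "finite {i \<in> I. h i \<noteq> \<one>\<^bsub>G i\<^esub>}"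
      using h assms by (auto simp: carrier_sum_group)
    have c: "x \<otimes>\<^bsub>?P\<^esub> h \<otimes>\<^bsub>?P\<^esub> inv\<^bsub>?P\<^esub> x \<in> carrier ?P"
      using x hc by (metis P.inv_closed P.m_closed)
    have "(x \<otimes>\<^bsub>?P\<^esub> h \<otimes>\<^bsub>?P\<^esub> inv\<^bsub>?P\<^esub> x) i = \<one>\<^bsub>G i\<^esub>" if i: "i \<in> I" "h i = \<one>\<^bsub>G i\<^esub>" for i
    proof -
      interpret group "G i" using assms i by blast
      have "x i \<in> carrier (G i)" using x i by auto
      then show ?thesis using x i assms by simp
    qed
    then have "{i \<in> I. (x \<otimes>\<^bsub>?P\<^esub> h \<otimes>\<^bsub>?P\<^esub> inv\<^bsub>?P\<^esub> x) i \<noteq> \<one>\<^bsub>G i\<^esub>} \<subseteq> {i \<in> I. h i \<noteq> \<one>\<^bsub>G i\<^esub>}" by blast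
    then show ?thesis
      using c finite_subset[OF _ fin] assms by (simp add: carrier_sum_group)
  qed
  moreover have "subgroup (carrier (sum_group I G)) ?P"
    using subgroup_sum_group[OF assms] assms by (simp add: carrier_sum_group)
  ultimately show ?thesis using P.normal_inv_iff by blast
qed

lemma sequentially_solvable_reduced_product:
  assumes grp: "\<And>i. group (G i)"
  shows "sequentially_solvable (reduced_product G)"
  unfolding sequentially_solvable_def
proof (intro allI impI)
  let ?P = "product_group UNIV G" and ?N = "carrier (sum_group UNIV G)"
  interpret normal ?N ?P by (rule sum_group_normal) (rule grp)
  have P: "group ?P" using grp by simp
  fix a :: "nat \<Rightarrow> _" and d :: "nat \<Rightarrow> int" assume "\<forall>n. a n \<in> carrier (reduced_product G)"
  then have "\<forall>n. \<exists>g. g \<in> carrier ?P \<and> a n = ?N #>\<^bsub>?P\<^esub> g"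
    unfolding reduced_product_def carrier_FactGroup by blast
  then obtain g where g: "\<And>n. g n \<in> carrier ?P" "\<And>n. a n = ?N #>\<^bsub>?P\<^esub> g n" by metis
  have gc: "g n i \<in> carrier (G i)" for n i using g(1)[of n] by auto
  \<comment> \<open>Modulo \<open>?N\<close>, each equation may fail in finitely many coordinates, so in coordinate \<open>i\<close> only the
    equations with \<open>n \<le> i\<close> are needed. They are solved downwards from the value \<open>1\<close> at \<open>Suc i\<close>;
    \<open>y i k n\<close> is the value at \<open>n\<close> when the recursion starts at \<open>n + k\<close>.\<close>
  define y where "y i = rec_nat (\<lambda>n. \<one>\<^bsub>G i\<^esub>) (\<lambda>k Y n. g n i \<otimes>\<^bsub>G i\<^esub> Y (Suc n) [^]\<^bsub>G i\<^esub> d n)" for i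
  have y0: "y i 0 n = \<one>\<^bsub>G i\<^esub>"
    and yS: "y i (Suc k) n = g n i \<otimes>\<^bsub>G i\<^esub> y i k (Suc n) [^]\<^bsub>G i\<^esub> d n" for i k n
    by (simp_all add: y_def)
  have yc: "y i k n \<in> carrier (G i)" for i k n
  proof -
    interpret Gi: group "G i" by (rule grp)
    show ?thesis by (induction k arbitrary: n) (auto simp: y0 yS gc)
  qed
  \<comment> \<open>With depth \<open>Suc i - n\<close> all recursions in coordinate
    \<open>i\<close> start at the same place \<open>Suc i\<close>, so that they fit together. For
    \<open>n > i\<close> the truncated difference is 0 and the entry is the identity.\<close>
  define x where "x n = (\<lambda>i. y i (Suc i - n) n)" for n
  have xc: "x n \<in> carrier ?P" for n by (simp add: x_def yc PiE_UNIV_domain)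
  have x_eq: "x n i = (g n \<otimes>\<^bsub>?P\<^esub> x (Suc n) [^]\<^bsub>?P\<^esub> d n) i" if "n \<le> i" for n i
  proof -
    have "Suc i - n = Suc (Suc i - Suc n)" using that by simp
    then have "x n i = g n i \<otimes>\<^bsub>G i\<^esub> x (Suc n) i [^]\<^bsub>G i\<^esub> d n" unfolding x_def by (metis yS)
    then show ?thesis using int_pow_product_group[OF grp xc[of "Suc n"], of i] by simp
  qed
  have "?N #>\<^bsub>?P\<^esub> x n = a n \<otimes>\<^bsub>reduced_product G\<^esub> (?N #>\<^bsub>?P\<^esub> x (Suc n)) [^]\<^bsub>reduced_product G\<^esub> d n" for n
  proof -
    let ?r = "g n \<otimes>\<^bsub>?P\<^esub> x (Suc n) [^]\<^bsub>?P\<^esub> d n"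
    have rc: "x (Suc n) [^]\<^bsub>?P\<^esub> d n \<in> carrier ?P" "?r \<in> carrier ?P"
      using g(1) xc int_pow_closed m_closed by meson+
    \<comment> \<open>The \<open>n\<close>-th equation can fail only in coordinates
      \<open>i < n\<close>, so the quotient of its two sides has finite support.\<close>
    have "x n \<otimes>\<^bsub>?P\<^esub> inv\<^bsub>?P\<^esub> ?r \<in> ?N"
    proof -
      let ?z = "x n \<otimes>\<^bsub>?P\<^esub> inv\<^bsub>?P\<^esub> ?r"
      have zc: "?z \<in> carrier ?P" using rc xc inv_closed m_closed by meson
      have "?z i = \<one>\<^bsub>G i\<^esub>" if "n \<le> i" for i
      proof -
        interpret Gi: group "G i" by (rule grp)
        have "?z i = x n i \<otimes>\<^bsub>G i\<^esub> inv\<^bsub>G i\<^esub> ?r i"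
          using inv_product_group[of ?r UNIV G] rc(2) grp by simp
        also have "\<dots> = \<one>\<^bsub>G i\<^esub>"
        proof -
          have "?r i \<in> carrier (G i)" using rc(2) by (metis PiE_mem UNIV_I carrier_product_group)
          then show ?thesis using x_eq[OF that] Gi.r_inv by metis
        qed
        finally show ?thesis .
      qed
      then have "{i \<in> UNIV. ?z i \<noteq> \<one>\<^bsub>G i\<^esub>} \<subseteq> {..<n}"
        by (metis (mono_tags, lifting) lessThan_iff mem_Collect_eq not_le_imp_less subsetI)
      then have "finite {i \<in> UNIV. ?z i \<noteq> \<one>\<^bsub>G i\<^esub>}" by (rule finite_subset) simp
      then show ?thesis using zc carrier_sum_group[of UNIV G] grp by simp
    qed
    then have "x n \<in> ?N #>\<^bsub>?P\<^esub> ?r"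
      using rcos_module[OF P rc(2) xc] by blast
    then have "?N #>\<^bsub>?P\<^esub> x n = ?N #>\<^bsub>?P\<^esub> ?r"
      using repr_independence rc(2) subgroup_axioms by metis
    also have "\<dots> = (?N #>\<^bsub>?P\<^esub> g n) <#>\<^bsub>?P\<^esub> (?N #>\<^bsub>?P\<^esub> (x (Suc n) [^]\<^bsub>?P\<^esub> d n))"
      using rcos_sum g(1) rc(1) by metis
    finally show ?thesis
      using FactGroup_int_pow[OF xc, of "Suc n" "d n"] g(2)[of n] by (simp add: reduced_product_def)
  qed
  moreover have "?N #>\<^bsub>?P\<^esub> x n \<in> carrier (reduced_product G)" for n
    using xc unfolding reduced_product_def carrier_FactGroup by blast
  ultimately show "\<exists>x. \<forall>n. x n \<in> carrier (reduced_product G) \<and>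
      x n = a n \<otimes>\<^bsub>reduced_product G\<^esub> x (Suc n) [^]\<^bsub>reduced_product G\<^esub> d n"
    by (intro exI[of _ "\<lambda>n. ?N #>\<^bsub>?P\<^esub> x n"] allI conjI)
qed

section \<open>Extending homomorphisms from isolated subgroups\<close>

lemma (in comm_group) torsion_free_int_pow_eq_one:
  assumes "torsion_free_group G" "x \<in> carrier G" "x [^] (k::int) = \<one>" "k \<noteq> 0"
  shows "x = \<one>"
proof (cases "k > 0")
  case True
  then obtain n where "k = int n" "n > 0" using zero_less_imp_eq_int by blast
  then show ?thesis using assms unfolding torsion_free_group_def by (metis int_pow_int)
next
  case False
  define n where "n = nat (- k)"
  have n: "k = - int n" "n > 0" using False assms(4) by (auto simp: n_def)
  have "inv (x [^] n) = \<one>" using assms(2,3) n(1) by (simp add: int_pow_neg_int)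
  then have "x [^] n = \<one>" using assms(2) by (simp add: inv_eq_1_iff)
  then show ?thesis using assms(1,2) n(2) unfolding torsion_free_group_def by blast
qed

text \<open>
  The elements with a power in \<open>\<langle>b\<rangle>\<close> form a group isomorphic to a subgroup of the rationals. It is the
  union of the increasing cyclic subgroups \<open>{y. y ^ n! \<in> \<langle>b\<rangle>}\<close>, and \<open>u n\<close> generates the \<open>n\<close>-th one.
\<close>

lemma (in comm_group) rank_one_chain:
  assumes tf: "torsion_free_group G" and b: "b \<in> carrier G" "b \<noteq> \<one>"
  obtains u :: "nat \<Rightarrow> 'a" and d :: "nat \<Rightarrow> int" where
    "\<And>n. u n \<in> carrier G" "\<And>n. u n = u (Suc n) [^] d n"
    "\<And>n k. u n [^] (k::int) = \<one> \<Longrightarrow> k = 0"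
    "\<And>n. \<exists>N::nat. \<exists>m::int. N > 0 \<and> u n [^] N = b [^] m"
    "\<And>y N m. y \<in> carrier G \<Longrightarrow> N > (0::nat) \<Longrightarrow> y [^] N = b [^] (m::int) \<Longrightarrow> \<exists>n k. y = u n [^] (k::int)"
proof -
  note tf1 = torsion_free_int_pow_eq_one[OF tf]
  \<comment> \<open>\<open>M n m\<close> says that the power of \<open>b\<close> with positive
    exponent \<open>m\<close> has an \<open>n!\<close>-th root. The least such exponent is
    \<open>r n\<close>, and \<open>u n\<close> is a root for it.\<close>
  define M where "M n m \<longleftrightarrow> m > (0::nat) \<and> (\<exists>y\<in>carrier G. y [^] (fact n :: int) = b [^] int m)" for n m
  have M: "M n (fact n)" for n
    unfolding M_def using b(1) by (auto intro!: bexI[of _ b])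
  define r where "r n = (LEAST m. M n m)" for n
  have r: "M n (r n)" for n unfolding r_def using M by (rule LeastI)
  have r_least: "r n \<le> m" if "M n m" for n m unfolding r_def using that by (rule Least_le)
  obtain u where u: "\<And>n. u n \<in> carrier G" "\<And>n. u n [^] (fact n :: int) = b [^] int (r n)"
    using r unfolding M_def by metis
  have rpos: "r n > 0" for n using r M_def by blast
  have gen: "\<exists>k::int. y = u n [^] k"
    if y: "y \<in> carrier G" "y [^] (fact n :: int) = b [^] (m::int)" for y n m
  proof -
    \<comment> \<open>Division with remainder: \<open>z\<close> is an \<open>n!\<close>-th root of
      \<open>b [^] (m mod int (r n))\<close>. Minimality of \<open>r n\<close> makes the remainder
      0, and then \<open>z\<close> is torsion, hence trivial.\<close>
    define q where "q = m div int (r n)"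
    define z where "z = y \<otimes> u n [^] (- q)"
    have zc: "z \<in> carrier G" using y u by (simp add: z_def)
    have "z [^] (fact n :: int) = y [^] (fact n :: int) \<otimes> (u n [^] (fact n :: int)) [^] (- q)"
    proof -
      have "(u n [^] (- q)) [^] (fact n :: int) = (u n [^] (fact n :: int)) [^] (- q)"
        using u(1) by (simp only: int_pow_pow mult.commute)
      then show ?thesis using y(1) u(1) by (simp add: z_def int_pow_distrib)
    qed
    also have "\<dots> = b [^] (m + int (r n) * (- q))"
      using b(1) by (simp only: y(2) u(2) int_pow_pow int_pow_mult)
    also have "m + int (r n) * (- q) = m mod int (r n)"
      unfolding q_def by (simp add: minus_div_mult_eq_mod mult.commute minus_mult_div_eq_mod)
    finally have z: "z [^] (fact n :: int) = b [^] (m mod int (r n))" .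
    have "m mod int (r n) = 0"
    proof (rule ccontr)
      assume "m mod int (r n) \<noteq> 0"
      moreover have "m mod int (r n) \<ge> 0" "m mod int (r n) < int (r n)"
        using rpos[of n] by simp_all
      ultimately obtain l where l: "m mod int (r n) = int l" "l > 0" "l < r n"
        by (metis nat_int nat_less_iff pos_int_cases order_le_less)
      then have "M n l" unfolding M_def using z zc by auto
      then show False using r_least l(3) by fastforce
    qed
    then have "z [^] (fact n :: int) = \<one>" using z by simp
    then have "z = \<one>" using tf1[OF zc] by simp
    then have "y = u n [^] q"
      using y(1) u(1) unfolding z_def by (simp add: int_pow_neg inv_solve_right')
    then show ?thesis by blast
  qed
  have "\<exists>k::int. u n = u (Suc n) [^] k" for n
  proof (rule gen[OF u(1)])
    have "u n [^] (fact (Suc n) :: int) = (u n [^] (fact n :: int)) [^] int (Suc n)"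
      using u(1) by (simp add: int_pow_pow mult.commute)
    then show "u n [^] (fact (Suc n) :: int) = b [^] (int (r n) * int (Suc n))"
      using u(2) b(1) by (simp add: int_pow_pow)
  qed
  then obtain d :: "nat \<Rightarrow> int" where d: "\<And>n. u n = u (Suc n) [^] d n" by metis
  have indep: "k = 0" if "u n [^] (k::int) = \<one>" for n k
  proof (rule ccontr)
    assume "k \<noteq> 0"
    have "b [^] (int (r n) * k) = (u n [^] k) [^] (fact n :: int)"
      using u b(1) by (metis int_pow_pow mult.commute)
    then show False using that tf1[OF b(1), of "int (r n) * k"] b(2) \<open>k \<noteq> 0\<close> rpos[of n] by simp
  qed
  have pw: "\<exists>N::nat. \<exists>m::int. N > 0 \<and> u n [^] N = b [^] m" for n
  proof (intro exI conjI)
    show "u n [^] (fact n :: nat) = b [^] int (r n)"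
      using u(2)[of n] int_pow_int[of G "u n" "fact n"] by simp
  qed simp
  have ex: "\<exists>n k. y = u n [^] (k::int)"
    if y: "y \<in> carrier G" "N > (0::nat)" "y [^] N = b [^] (m::int)" for y N m
  proof -
    \<comment> \<open>An element with its \<open>N\<close>-th power in the group generated by
      \<open>b\<close> is caught at stage \<open>N\<close>, because \<open>N\<close> divides
      \<open>N!\<close>.\<close>
    have "N dvd fact N" using y(2) by (simp add: dvd_fact)
    then obtain l where l: "fact N = N * l" by (auto elim: dvdE)
    have "y [^] (fact N :: int) = (y [^] int N) [^] int l"
      using y(1) l by (metis int_pow_pow of_nat_fact of_nat_mult)
    also have "\<dots> = b [^] (m * int l)"
    proof -
      have "y [^] int N = b [^] m" by (simp only: y(3) int_pow_int)
      then show ?thesis by (simp only: int_pow_pow[OF b(1)])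
    qed
    finally show ?thesis using gen[OF y(1)] by blast
  qed
  show thesis by (rule that[OF u(1) d indep pw ex])
qed

section \<open>Unions of chains, direct products and cosets\<close>

lemma (in group) subgroup_chain_Union:
  assumes ne: "C \<noteq> {}" and sub: "\<And>H. H \<in> C \<Longrightarrow> subgroup H G"
    and chain: "\<And>X Y. X \<in> C \<Longrightarrow> Y \<in> C \<Longrightarrow> X \<subseteq> Y \<or> Y \<subseteq> X"
  shows "subgroup (\<Union>C) G"
proof
  show "\<Union>C \<subseteq> carrier G" using sub subgroup.subset by blast
  show "x \<otimes> y \<in> \<Union>C" if xy: "x \<in> \<Union>C" "y \<in> \<Union>C" for x y
  proof -
    obtain X Y where "X \<in> C" "Y \<in> C" "x \<in> X" "y \<in> Y" using xy by blast
    then obtain Z where "Z \<in> C" "x \<in> Z" "y \<in> Z" using chain[of X Y] by blast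
    then show ?thesis using subgroup.m_closed[OF sub] by blast
  qed
  show "\<one> \<in> \<Union>C" using ne subgroup.one_closed[OF sub] by blast
  show "inv x \<in> \<Union>C" if "x \<in> \<Union>C" for x
    using that subgroup.m_inv_closed[OF sub] by blast
qed

lemma comm_group_DirProd:
  assumes "comm_group G" "comm_group H"
  shows "comm_group (G \<times>\<times> H)"
proof -
  interpret G: comm_group G by fact
  interpret H: comm_group H by fact
  show ?thesis
    by (rule group.group_comm_groupI[OF DirProd_group[OF G.is_group H.is_group]])
      (auto simp: G.m_comm H.m_comm)
qed

lemma int_pow_DirProd:
  assumes "group G" "group H" "x \<in> carrier G" "y \<in> carrier H"
  shows "(x, y) [^]\<^bsub>G \<times>\<times> H\<^esub> (k::int) = (x [^]\<^bsub>G\<^esub> k, y [^]\<^bsub>H\<^esub> k)"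
proof -
  interpret D: group "G \<times>\<times> H" using assms by (rule_tac DirProd_group)
  have "group_hom (G \<times>\<times> H) G fst" "group_hom (G \<times>\<times> H) H snd"
    using assms(1,2) D.is_group by (auto simp: group_hom_def group_hom_axioms_def hom_def)
  then have "fst ((x, y) [^]\<^bsub>G \<times>\<times> H\<^esub> k) = x [^]\<^bsub>G\<^esub> k" "snd ((x, y) [^]\<^bsub>G \<times>\<times> H\<^esub> k) = y [^]\<^bsub>H\<^esub> k"
    using assms(3,4) by (auto simp: group_hom.hom_int_pow)
  then show ?thesis by (metis prod.collapse)
qed

lemma (in comm_group) rcos_eq_iff:
  assumes "subgroup S G" "x \<in> carrier G" "y \<in> carrier G"
  shows "S #> x = S #> y \<longleftrightarrow> x \<otimes> inv y \<in> S"
proof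
  assume "S #> x = S #> y"
  then have "x \<in> S #> y" using rcos_self[OF assms(2,1)] by simp
  then show "x \<otimes> inv y \<in> S"
    using subgroup.rcos_module[OF assms(1) is_group assms(3,2)] by simp
next
  assume "x \<otimes> inv y \<in> S"
  then have "x \<in> S #> y"
    using subgroup.rcos_module[OF assms(1) is_group assms(3,2)] by simp
  then show "S #> x = S #> y"
    using repr_independence[OF _ assms(3,1)] by simp
qed

lemma (in comm_group) rcos_eq_self_iff:
  assumes "subgroup S G" "x \<in> carrier G"
  shows "S #> x = S \<longleftrightarrow> x \<in> S"
  using assms coset_join1 coset_join2 subgroup.subset by metis

text \<open>Stronger than purity, which asks only that some \<open>n\<close>-th root of
  \<open>y [^] n\<close> lie in \<open>S\<close>: here \<open>y\<close> itself must. This is what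
  corresponds to a torsion-free quotient.\<close>

definition (in monoid) isolated :: "'a set \<Rightarrow> bool" where
  "isolated S \<longleftrightarrow> (\<forall>y\<in>carrier G. \<forall>n::nat. n > 0 \<longrightarrow> y [^] n \<in> S \<longrightarrow> y \<in> S)"

lemma (in comm_group) torsion_free_Mod_iff:
  assumes S: "subgroup S G"
  shows "torsion_free_group (G Mod S) \<longleftrightarrow> isolated S"
proof -
  interpret normal S G using S subgroup_imp_normal by blast
  have "(S #> y) [^]\<^bsub>G Mod S\<^esub> n = \<one>\<^bsub>G Mod S\<^esub> \<longleftrightarrow> y [^] n \<in> S"
    if "y \<in> carrier G" for y and n :: nat
    using that by (simp add: FactGroup_pow rcos_eq_self_iff[OF S])
  then show ?thesis
    unfolding torsion_free_group_def isolated_def carrier_FactGroup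
    using factorgroup_is_group rcos_eq_self_iff[OF S] by auto
qed

text \<open>
  A subgroup of \<open>G \<times>\<times> A\<close> that is single-valued at \<open>\<one>\<close> is the graph of a homomorphism from a subgroup of
  \<open>G\<close> to \<open>A\<close>. Extending it to the isolated subgroup generated by its domain and \<open>b\<close> means choosing
  images \<open>x n\<close> of the generators \<open>u n = c n \<otimes> u (Suc n) [^] d n\<close>, and these must solve exactly a system
  of the kind that is solvable in \<open>A\<close>.
\<close>

lemma (in comm_group) single_valued_extension_step:
  assumes A: "comm_group A" "sequentially_solvable A"
    and H: "subgroup H (G \<times>\<times> A)" and sv: "\<And>z. (\<one>, z) \<in> H \<Longrightarrow> z = \<one>\<^bsub>A\<^esub>"
    and pure: "isolated (fst ` H)"
    and b: "b \<in> carrier G" "b \<notin> fst ` H"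
  shows "\<exists>H'. subgroup H' (G \<times>\<times> A) \<and> (\<forall>z. (\<one>, z) \<in> H' \<longrightarrow> z = \<one>\<^bsub>A\<^esub>) \<and>
    isolated (fst ` H') \<and> H \<subseteq> H' \<and> b \<in> fst ` H'"
proof -
  let ?D = "G \<times>\<times> A"
  interpret A: comm_group A by fact
  interpret D: comm_group ?D using comm_group_DirProd[OF comm_group_axioms A(1)] .
  interpret fst: group_hom ?D G fst
    by unfold_locales (auto simp: hom_def)
  interpret H: subgroup H ?D by fact
  define S where "S = fst ` H"
  have S: "subgroup S G" unfolding S_def by (rule fst.subgroup_img_is_subgroup[OF H])
  interpret S: normal S G using S subgroup_imp_normal by blast
  let ?Q = "G Mod S"
  interpret Q: comm_group ?Q using abelian_FactGroup[OF S] .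
  have Qc: "S #> y \<in> carrier ?Q" if "y \<in> carrier G" for y using that by (auto simp: carrier_FactGroup)
  \<comment> \<open>The quotient by the isolated subgroup \<open>S\<close> is torsion-free, so the
    elements of it with a positive power in the group generated by \<open>S #> b\<close> form a
    union of cyclic groups, generated by the \<open>U n\<close>.\<close>
  have tf: "torsion_free_group ?Q" using torsion_free_Mod_iff[OF S] pure S_def by simp
  have b1: "S #> b \<noteq> \<one>\<^bsub>?Q\<^esub>" using b rcos_eq_self_iff[OF S] S_def by simp
  obtain U and d :: "nat \<Rightarrow> int" where
    U: "\<And>n. U n \<in> carrier ?Q" "\<And>n. U n = U (Suc n) [^]\<^bsub>?Q\<^esub> d n"
      "\<And>n k. U n [^]\<^bsub>?Q\<^esub> (k::int) = \<one>\<^bsub>?Q\<^esub> \<Longrightarrow> k = 0"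
      "\<And>n. \<exists>N::nat. \<exists>m::int. N > 0 \<and> U n [^]\<^bsub>?Q\<^esub> N = (S #> b) [^]\<^bsub>?Q\<^esub> m"
      "\<And>y N m. y \<in> carrier ?Q \<Longrightarrow> N > (0::nat) \<Longrightarrow> y [^]\<^bsub>?Q\<^esub> N = (S #> b) [^]\<^bsub>?Q\<^esub> (m::int) \<Longrightarrow>
         \<exists>n k. y = U n [^]\<^bsub>?Q\<^esub> (k::int)"
    using Q.rank_one_chain[OF tf Qc[OF b(1)] b1] by blast
  have "\<forall>n. \<exists>g. g \<in> carrier G \<and> U n = S #> g" using U(1) by (auto simp: carrier_FactGroup)
  then obtain u where u: "\<And>n. u n \<in> carrier G" "\<And>n. U n = S #> u n" by metis
  have Upow: "U n [^]\<^bsub>?Q\<^esub> k = S #> (u n [^] k)" for n and k :: int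
    using u by (simp add: S.FactGroup_int_pow)
  \<comment> \<open>The relations between the \<open>U n\<close> hold for the lifts
    \<open>u n\<close> only up to factors \<open>c n\<close> in \<open>S\<close>. On these the
    partial homomorphism is already defined, with values \<open>e n\<close>.\<close>
  define c where "c n = u n \<otimes> inv (u (Suc n) [^] d n)" for n
  have "c n \<in> S" for n
  proof -
    have "S #> u n = S #> (u (Suc n) [^] d n)"
      using U(2)[of n] unfolding Upow u(2)[of n] .
    then show ?thesis unfolding c_def using rcos_eq_iff[OF S] u(1) by simp
  qed
  then have "\<forall>n. \<exists>e. (c n, e) \<in> H" unfolding S_def by force
  then obtain e where e: "\<And>n. (c n, e n) \<in> H" by metis
  then have ec: "e n \<in> carrier A" "c n \<in> carrier G" for n using H.subset[THEN subsetD, OF e[of n]] by simp_all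
  \<comment> \<open>Solving this system makes the pairs \<open>w n = (u n, x n)\<close> satisfy the
    same relations as the \<open>u n\<close>, with factors from \<open>H\<close>. Hence the groups
    \<open>K n\<close> generated by \<open>H\<close> and \<open>w n\<close> increase.\<close>
  obtain x where x: "\<And>n. x n \<in> carrier A" "\<And>n. x n = e n \<otimes>\<^bsub>A\<^esub> x (Suc n) [^]\<^bsub>A\<^esub> d n"
    by (rule sequentially_solvableD[OF A(2), of e d, OF ec(1)]) blast
  define w where "w n = (u n, x n)" for n
  have wc: "w n \<in> carrier ?D" for n using u(1) x(1) by (simp add: w_def)
  have wpow: "w n [^]\<^bsub>?D\<^esub> k = (u n [^] k, x n [^]\<^bsub>A\<^esub> k)" for n and k :: int
    unfolding w_def using u(1) x(1) int_pow_DirProd[OF is_group A.is_group] by blast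
  have w: "w n = (c n, e n) \<otimes>\<^bsub>?D\<^esub> w (Suc n) [^]\<^bsub>?D\<^esub> d n" for n
  proof -
    have "u n = c n \<otimes> u (Suc n) [^] d n" unfolding c_def using u(1) by (simp add: m_assoc)
    then show ?thesis using x(2)[of n] unfolding wpow by (simp add: w_def)
  qed
  define K where "K n = H <#>\<^bsub>?D\<^esub> range (\<lambda>k::int. w n [^]\<^bsub>?D\<^esub> k)" for n
  have K_iff: "g \<in> K n \<longleftrightarrow> (\<exists>h\<in>H. \<exists>k::int. g = h \<otimes>\<^bsub>?D\<^esub> w n [^]\<^bsub>?D\<^esub> k)" for g n
    unfolding K_def set_mult_def by blast
  have Ksub: "subgroup (K n) ?D" for n
    unfolding K_def by (rule D.mult_subgroups[OF H D.subgroup_of_powers[OF wc]])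
  have "K n \<subseteq> K (Suc n)" for n
  proof
    fix g assume "g \<in> K n"
    then obtain h k where h: "h \<in> H" and g: "g = h \<otimes>\<^bsub>?D\<^esub> w n [^]\<^bsub>?D\<^esub> (k::int)" unfolding K_iff by blast
    have ce: "(c n, e n) \<in> carrier ?D" using ec by simp
    have "w n [^]\<^bsub>?D\<^esub> k = (c n, e n) [^]\<^bsub>?D\<^esub> k \<otimes>\<^bsub>?D\<^esub> w (Suc n) [^]\<^bsub>?D\<^esub> (d n * k)"
      unfolding w[of n] using ce wc by (simp only: D.int_pow_distrib D.int_pow_closed D.int_pow_pow)
    then have "g = (h \<otimes>\<^bsub>?D\<^esub> (c n, e n) [^]\<^bsub>?D\<^esub> k) \<otimes>\<^bsub>?D\<^esub> w (Suc n) [^]\<^bsub>?D\<^esub> (d n * k)"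
      unfolding g using ce wc h H.mem_carrier by (simp only: D.m_assoc D.int_pow_closed)
    moreover have "h \<otimes>\<^bsub>?D\<^esub> (c n, e n) [^]\<^bsub>?D\<^esub> k \<in> H"
      using h D.subgroup_int_pow_closed[OF H e] H.m_closed by blast
    ultimately show "g \<in> K (Suc n)" unfolding K_iff by blast
  qed
  then have mono: "K n \<subseteq> K m" if "n \<le> m" for n m using lift_Suc_mono_le[of K, OF _ that] by blast
  define H' where "H' = (\<Union>n. K n)"
  have H': "subgroup H' ?D"
    unfolding H'_def
  proof (rule D.subgroup_chain_Union)
    show "X \<subseteq> Y \<or> Y \<subseteq> X" if "X \<in> range K" "Y \<in> range K" for X Y
      using that mono by (metis imageE nle_le)
  qed (use Ksub in auto)
  have cover: "y \<in> fst ` H'" if y: "y \<in> carrier G" "S #> y = U n [^]\<^bsub>?Q\<^esub> k" for y n and k :: int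
  proof -
    have "y \<otimes> inv (u n [^] k) \<in> S"
      using y(2) rcos_eq_iff[OF S y(1)] u(1) unfolding Upow by simp
    then obtain z where z: "(y \<otimes> inv (u n [^] k), z) \<in> H" unfolding S_def by force
    have "(y \<otimes> inv (u n [^] k), z) \<otimes>\<^bsub>?D\<^esub> w n [^]\<^bsub>?D\<^esub> k \<in> H'" unfolding H'_def using K_iff z by blast
    moreover have "fst ((y \<otimes> inv (u n [^] k), z) \<otimes>\<^bsub>?D\<^esub> w n [^]\<^bsub>?D\<^esub> k) = y"
      unfolding wpow using y(1) u(1) by (simp add: m_assoc)
    ultimately show ?thesis by (metis imageI)
  qed
  \<comment> \<open>A pair over the identity involves a power of \<open>w n\<close> whose first
    component lies in \<open>S\<close>. As \<open>U n\<close> has infinite order, the exponent is 0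
    and the pair is already in \<open>H\<close>.\<close>
  have "z = \<one>\<^bsub>A\<^esub>" if z: "(\<one>, z) \<in> H'" for z
  proof -
    obtain n h k where h: "h \<in> H" and g: "(\<one>, z) = h \<otimes>\<^bsub>?D\<^esub> w n [^]\<^bsub>?D\<^esub> (k::int)"
      using z unfolding H'_def using K_iff by blast
    have hS: "fst h \<in> S" unfolding S_def using h by blast
    have "\<one> = fst h \<otimes> u n [^] k" using arg_cong[OF g, of fst] unfolding wpow mult_DirProd' by simp
    then have "u n [^] k = inv (fst h)"
      using hS S.mem_carrier u(1) by (metis int_pow_closed inv_equality inv_inv m_comm)
    then have "u n [^] k \<in> S" using hS S.m_inv_closed by simp
    then have "U n [^]\<^bsub>?Q\<^esub> k = \<one>\<^bsub>?Q\<^esub>" unfolding Upow using rcos_eq_self_iff[OF S] u(1) by simp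
    then have "k = 0" by (rule U(3))
    then have "(\<one>, z) = h" using g h H.mem_carrier D.r_one by simp
    then show ?thesis using sv h by blast
  qed
  \<comment> \<open>If \<open>y [^] N\<close> is in the new domain, its coset is a power of
    \<open>U n\<close>, so the further power \<open>N * N2\<close> of the coset of \<open>y\<close>
    is a power of \<open>S #> b\<close>. Then this coset is itself a power of some
    \<open>U n'\<close>, and \<open>cover\<close> applies.\<close>
  moreover have "isolated (fst ` H')"
    unfolding isolated_def
  proof (intro ballI allI impI)
    fix y and N :: nat assume y: "y \<in> carrier G" and N: "N > 0" and yN: "y [^] N \<in> fst ` H'"
    obtain g n where "g \<in> K n" and yg: "y [^] N = fst g" using yN unfolding H'_def by blast
    then obtain h k where h: "h \<in> H" and "g = h \<otimes>\<^bsub>?D\<^esub> w n [^]\<^bsub>?D\<^esub> (k::int)"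
      unfolding K_iff by blast
    then have g: "y [^] N = fst (h \<otimes>\<^bsub>?D\<^esub> w n [^]\<^bsub>?D\<^esub> k)" using yg by simp
    have hS: "fst h \<in> S" unfolding S_def using h by blast
    have "y [^] N = fst h \<otimes> u n [^] k" using g unfolding wpow mult_DirProd' by simp
    then have "y [^] N \<otimes> inv (u n [^] k) \<in> S" using hS S.mem_carrier u(1) by (simp add: m_assoc)
    then have "S #> (y [^] N) = S #> (u n [^] k)" using rcos_eq_iff[OF S] y u(1) by simp
    then have eq: "(S #> y) [^]\<^bsub>?Q\<^esub> int N = U n [^]\<^bsub>?Q\<^esub> k"
      unfolding Upow using S.FactGroup_pow[OF y] by (simp add: int_pow_int)
    obtain N2 :: nat and m :: int where N2: "N2 > 0" "U n [^]\<^bsub>?Q\<^esub> N2 = (S #> b) [^]\<^bsub>?Q\<^esub> m"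
      using U(4) by blast
    have "(S #> y) [^]\<^bsub>?Q\<^esub> int (N * N2) = ((S #> y) [^]\<^bsub>?Q\<^esub> int N) [^]\<^bsub>?Q\<^esub> int N2"
      by (simp only: Q.int_pow_pow[OF Qc[OF y]] of_nat_mult)
    also have "\<dots> = (U n [^]\<^bsub>?Q\<^esub> int N2) [^]\<^bsub>?Q\<^esub> k"
      by (simp only: eq Q.int_pow_pow[OF U(1)] mult.commute)
    also have "\<dots> = (S #> b) [^]\<^bsub>?Q\<^esub> (m * k)"
      by (simp only: int_pow_int N2(2) Q.int_pow_pow[OF Qc[OF b(1)]])
    finally have pw: "(S #> y) [^]\<^bsub>?Q\<^esub> (N * N2) = (S #> b) [^]\<^bsub>?Q\<^esub> (m * k)" unfolding int_pow_int .
    have "N * N2 > 0" using N N2(1) by simp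
    then obtain n' k' where "S #> y = U n' [^]\<^bsub>?Q\<^esub> (k' :: int)"
      using U(5)[OF Qc[OF y] _ pw] by blast
    then show "y \<in> fst ` H'" using cover y by blast
  qed
  moreover have "H \<subseteq> H'"
  proof
    fix h assume h: "h \<in> H"
    then have "h = h \<otimes>\<^bsub>?D\<^esub> w 0 [^]\<^bsub>?D\<^esub> (0::int)" using H.mem_carrier D.r_one by simp
    then show "h \<in> H'" unfolding H'_def using K_iff h by blast
  qed
  moreover have "b \<in> fst ` H'"
  proof -
    have b1: "(S #> b) [^]\<^bsub>?Q\<^esub> (1::nat) = (S #> b) [^]\<^bsub>?Q\<^esub> (1::int)"
      by (metis int_pow_int of_nat_1)
    obtain n k where "S #> b = U n [^]\<^bsub>?Q\<^esub> (k :: int)"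
      using U(5)[OF Qc[OF b(1)] _ b1] by auto
    then show ?thesis using cover b(1) by blast
  qed
  ultimately show ?thesis using H' by blast
qed

text \<open>Partial extensions of \<open>h\<close> are handled as their graphs, so that Zorn's lemma
  applies to sets ordered by inclusion. Unions of chains keep the domain isolated, and the one-step
  extension shows that a maximal graph has full domain.\<close>

lemma (in comm_group) extend_hom_from_isolated_subgroup:
  assumes A: "comm_group A" "sequentially_solvable A"
    and N: "subgroup N G" "isolated N"
    and h: "h \<in> hom (G\<lparr>carrier := N\<rparr>) A"
  obtains g where "g \<in> hom G A" "\<And>x. x \<in> N \<Longrightarrow> g x = h x"
proof -
  let ?D = "G \<times>\<times> A"
  interpret A: comm_group A by fact
  interpret D: comm_group ?D using comm_group_DirProd[OF comm_group_axioms A(1)] .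
  interpret N: subgroup N G by fact
  define \<G> where "\<G> = {H. subgroup H ?D \<and> (\<forall>z. (\<one>, z) \<in> H \<longrightarrow> z = \<one>\<^bsub>A\<^esub>) \<and>
    isolated (fst ` H) \<and> (\<lambda>x. (x, h x)) ` N \<subseteq> H}"
  have Ngrp: "group (G\<lparr>carrier := N\<rparr>)" using N(1) by (rule subgroup_imp_group)
  interpret h: group_hom "G\<lparr>carrier := N\<rparr>" A h
    by (intro group_hom.intro group_hom_axioms.intro Ngrp A.is_group h)
  have "(\<lambda>x. (x, h x)) \<in> hom (G\<lparr>carrier := N\<rparr>) ?D"
    using h N.subset by (auto simp: hom_def)
  then interpret gr: group_hom "G\<lparr>carrier := N\<rparr>" ?D "\<lambda>x. (x, h x)"
    by (intro group_hom.intro group_hom_axioms.intro Ngrp D.is_group)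
  have graph: "(\<lambda>x. (x, h x)) ` N \<in> \<G>"
  proof -
    have "subgroup ((\<lambda>x. (x, h x)) ` N) ?D" using gr.img_is_subgroup by simp
    moreover have "fst ` (\<lambda>x. (x, h x)) ` N = N" by force
    ultimately show ?thesis using N(2) h.hom_one by (auto simp: \<G>_def)
  qed
  have "\<exists>M\<in>\<G>. \<forall>X\<in>\<G>. M \<subseteq> X \<longrightarrow> X = M"
  proof (rule subset_Zorn_nonempty)
    show "\<G> \<noteq> {}" using graph by blast
    fix C assume C: "C \<noteq> {}" "subset.chain \<G> C"
    then have CG: "C \<subseteq> \<G>" and chain: "\<And>X Y. X \<in> C \<Longrightarrow> Y \<in> C \<Longrightarrow> X \<subseteq> Y \<or> Y \<subseteq> X"
      by (auto simp: subset_chain_def)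
    have "subgroup (\<Union>C) ?D"
      by (rule D.subgroup_chain_Union[OF C(1) _ chain]) (use CG \<G>_def in auto)
    moreover have "z = \<one>\<^bsub>A\<^esub>" if z: "(\<one>, z) \<in> \<Union>C" for z
      using z CG unfolding \<G>_def by blast
    moreover have "isolated (fst ` \<Union>C)"
      unfolding isolated_def
    proof (intro ballI allI impI)
      fix y and n :: nat assume y: "y \<in> carrier G" "n > 0" "y [^] n \<in> fst ` \<Union>C"
      then obtain H where H: "H \<in> C" "y [^] n \<in> fst ` H" by blast
      then have "isolated (fst ` H)" using CG \<G>_def by blast
      then have "y \<in> fst ` H" using y H(2) unfolding isolated_def by blast
      then show "y \<in> fst ` \<Union>C" using H(1) by blast
    qed
    moreover have "(\<lambda>x. (x, h x)) ` N \<subseteq> \<Union>C" using C(1) CG \<G>_def by blast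
    ultimately show "\<Union>C \<in> \<G>" unfolding \<G>_def by blast
  qed
  then obtain H where HG: "H \<in> \<G>" and max: "\<And>X. X \<in> \<G> \<Longrightarrow> H \<subseteq> X \<Longrightarrow> X = H" by blast
  have H: "subgroup H ?D" and sv: "\<And>z. (\<one>, z) \<in> H \<Longrightarrow> z = \<one>\<^bsub>A\<^esub>"
    and pure: "isolated (fst ` H)" and gH: "(\<lambda>x. (x, h x)) ` N \<subseteq> H"
    using HG by (auto simp: \<G>_def)
  interpret H: subgroup H ?D by (rule H)
  have total: "b \<in> fst ` H" if b: "b \<in> carrier G" for b
  proof (rule ccontr)
    assume nb: "b \<notin> fst ` H"
    obtain H' where H': "subgroup H' ?D" "\<And>z. (\<one>, z) \<in> H' \<Longrightarrow> z = \<one>\<^bsub>A\<^esub>"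
      "isolated (fst ` H')" "H \<subseteq> H'" "b \<in> fst ` H'"
      using single_valued_extension_step[OF A H sv pure b nb] by blast
    then have "H' \<in> \<G>" using gH unfolding \<G>_def by blast
    then show False using max H'(4,5) nb by blast
  qed
  \<comment> \<open>The quotient of two pairs over the same \<open>x\<close> lies over the identity,
    so single-valuedness there suffices everywhere.\<close>
  have uniq: "y = z" if yz: "(x, y) \<in> H" "(x, z) \<in> H" for x y z
  proof -
    have c: "x \<in> carrier G" "y \<in> carrier A" "z \<in> carrier A"
      using H.subset yz by auto
    have "(x, y) \<otimes>\<^bsub>?D\<^esub> inv\<^bsub>?D\<^esub> (x, z) \<in> H" using yz H.m_closed H.m_inv_closed by blast
    then have "(\<one>, y \<otimes>\<^bsub>A\<^esub> inv\<^bsub>A\<^esub> z) \<in> H" using c inv_DirProd[OF is_group A.is_group] by simp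
    then have "y \<otimes>\<^bsub>A\<^esub> inv\<^bsub>A\<^esub> z = \<one>\<^bsub>A\<^esub>" by (rule sv)
    then show ?thesis using c A.inv_equality[of y "inv\<^bsub>A\<^esub> z"] by simp
  qed
  have "\<forall>x\<in>carrier G. \<exists>y. (x, y) \<in> H" using total by force
  then obtain g where g: "\<And>x. x \<in> carrier G \<Longrightarrow> (x, g x) \<in> H" by metis
  show thesis
  proof (rule that)
    show "g \<in> hom G A"
    proof (rule homI)
      show "g x \<in> carrier A" if "x \<in> carrier G" for x using H.subset g[OF that] by auto
      fix x y assume xy: "x \<in> carrier G" "y \<in> carrier G"
      have "(x \<otimes> y, g x \<otimes>\<^bsub>A\<^esub> g y) \<in> H" using H.m_closed[OF g[OF xy(1)] g[OF xy(2)]] by simp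
      then show "g (x \<otimes> y) = g x \<otimes>\<^bsub>A\<^esub> g y" using uniq g[of "x \<otimes> y"] xy by blast
    qed
    show "g x = h x" if "x \<in> N" for x
      using uniq g gH N.subset that by blast
  qed
qed

section \<open>Splitting of torsion-free extensions\<close>

text \<open>As \<open>C\<close> is torsion-free, the image of \<open>A\<close> is isolated in
  \<open>B\<close>, and the inverse of \<open>i\<close> on it extends to a retraction
  \<open>r\<close>. The complementary projection then induces a section of \<open>p\<close>.\<close>

lemma sequentially_solvable_imp_cotorsion:
  assumes A: "comm_group A" "sequentially_solvable A"
  shows "cotorsion TYPE('b) TYPE('c) A"
  unfolding cotorsion_def
proof (intro conjI allI impI, rule A(1))
  fix B :: "'b monoid" and C :: "'c monoid" and i p
  assume *: "comm_group B \<and> comm_group C \<and> torsion_free_group C \<and> short_exact A i B p C"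
  interpret A: comm_group A by fact
  interpret B: comm_group B using * by blast
  interpret C: comm_group C using * by blast
  have tf: "torsion_free_group C" and i: "i \<in> hom A B" and inj: "inj_on i (carrier A)"
    and p: "p \<in> hom B C" and surj: "p ` carrier B = carrier C"
    and ex: "i ` carrier A = kernel B C p"
    using * by (auto simp: short_exact_def mon_def epi_def)
  interpret i: group_hom A B i by unfold_locales (rule i)
  interpret p: group_hom B C p by unfold_locales (rule p)
  let ?N = "i ` carrier A"
  have N: "subgroup ?N B" by (rule i.img_is_subgroup)
  have pure: "B.isolated ?N"
    unfolding B.isolated_def ex
  proof (intro ballI allI impI)
    fix y and n :: nat assume y: "y \<in> carrier B" "n > 0" "y [^]\<^bsub>B\<^esub> n \<in> kernel B C p"
    then have "p y [^]\<^bsub>C\<^esub> n = \<one>\<^bsub>C\<^esub>" by (simp add: kernel_def p.hom_nat_pow)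
    then have "p y = \<one>\<^bsub>C\<^esub>" using tf y p.hom_closed unfolding torsion_free_group_def by blast
    then show "y \<in> kernel B C p" using y by (simp add: kernel_def)
  qed
  let ?h = "inv_into (carrier A) i"
  have hi: "?h (i a) = a" if "a \<in> carrier A" for a using inj that by (rule inv_into_f_f)
  have "?h \<in> hom (B\<lparr>carrier := ?N\<rparr>) A"
  proof (rule homI)
    fix x y assume "x \<in> carrier (B\<lparr>carrier := ?N\<rparr>)" "y \<in> carrier (B\<lparr>carrier := ?N\<rparr>)"
    then obtain a b where ab: "a \<in> carrier A" "b \<in> carrier A" "x = i a" "y = i b" by auto
    then show "?h (x \<otimes>\<^bsub>B\<lparr>carrier := ?N\<rparr>\<^esub> y) = ?h x \<otimes>\<^bsub>A\<^esub> ?h y"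
      using hi[of "a \<otimes>\<^bsub>A\<^esub> b"] by (simp add: hi)
  qed (auto simp: hi)
  then obtain r where r: "r \<in> hom B A" "\<And>x. x \<in> ?N \<Longrightarrow> r x = ?h x"
    by (rule B.extend_hom_from_isolated_subgroup[OF A N pure]) blast
  interpret r: group_hom B A r by unfold_locales (rule r(1))
  have ri: "r (i a) = a" if "a \<in> carrier A" for a using r(2) hi that by simp
  \<comment> \<open>\<open>f\<close> projects \<open>B\<close> along the image of \<open>A\<close>.
    It kills the kernel of \<open>p\<close> and does not change values under
    \<open>p\<close>.\<close>
  define f where "f b = b \<otimes>\<^bsub>B\<^esub> inv\<^bsub>B\<^esub> i (r b)" for b
  have fc: "f b \<in> carrier B" if "b \<in> carrier B" for b using that by (simp add: f_def)
  have f_hom: "f (x \<otimes>\<^bsub>B\<^esub> y) = f x \<otimes>\<^bsub>B\<^esub> f y" if "x \<in> carrier B" "y \<in> carrier B" for x y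
    unfolding f_def using that by (simp add: B.inv_mult B.m_ac)
  interpret f: group_hom B B f by unfold_locales (auto simp: hom_def fc f_hom)
  have f_ker: "f b = \<one>\<^bsub>B\<^esub>" if b: "b \<in> kernel B C p" for b
  proof -
    obtain a where a: "a \<in> carrier A" "b = i a" using b ex by blast
    then show ?thesis using ri by (simp add: f_def)
  qed
  have pf: "p (f b) = p b" if "b \<in> carrier B" for b
  proof -
    have "i (r b) \<in> kernel B C p" unfolding ex[symmetric] using that r.hom_closed by blast
    then have "p (i (r b)) = \<one>\<^bsub>C\<^esub>" by (simp add: kernel_def)
    then show ?thesis unfolding f_def using that by simp
  qed
  have f_eq: "f x = f y" if xy: "x \<in> carrier B" "y \<in> carrier B" "p x = p y" for x y
  proof -
    have "x \<otimes>\<^bsub>B\<^esub> inv\<^bsub>B\<^esub> y \<in> kernel B C p" using xy by (simp add: kernel_def)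
    then have "f x \<otimes>\<^bsub>B\<^esub> inv\<^bsub>B\<^esub> f y = \<one>\<^bsub>B\<^esub>" using f_ker xy by fastforce
    then show ?thesis using fc xy B.inv_equality[of "f x" "inv\<^bsub>B\<^esub> f y"] by simp
  qed
  have "\<forall>c\<in>carrier C. \<exists>b. b \<in> carrier B \<and> p b = c" unfolding surj[symmetric] by blast
  \<comment> \<open>\<open>l\<close> is only a choice of preimages. Since \<open>f\<close> is
    constant on the fibres of \<open>p\<close>, the composite of \<open>f\<close> with
    \<open>l\<close> is nevertheless a homomorphism.\<close>
  then obtain l where l: "\<And>c. c \<in> carrier C \<Longrightarrow> l c \<in> carrier B" "\<And>c. c \<in> carrier C \<Longrightarrow> p (l c) = c"
    by metis
  show "splits B p C"
    unfolding splits_def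
  proof (intro bexI ballI)
    show "(\<lambda>c. f (l c)) \<in> hom C B"
    proof (rule homI)
      fix x y assume xy: "x \<in> carrier C" "y \<in> carrier C"
      have "f (l (x \<otimes>\<^bsub>C\<^esub> y)) = f (l x \<otimes>\<^bsub>B\<^esub> l y)"
        by (rule f_eq) (use l xy in auto)
      then show "f (l (x \<otimes>\<^bsub>C\<^esub> y)) = f (l x) \<otimes>\<^bsub>B\<^esub> f (l y)"
        using f_hom l(1) xy by simp
    qed (use l fc in auto)
    show "p (f (l c)) = c" if "c \<in> carrier C" for c using that pf l by simp
  qed
qed

section \<open>Cotorsion groups as images of products of cyclic groups\<close>

text \<open>By \<open>ker\<close>, sending \<open>t \<otimes> \<iota> f\<close> to
  \<open>\<phi> f\<close> is well defined on the product of \<open>T\<close> and the image of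
  \<open>\<iota>\<close>, and it is onto \<open>A\<close>. Cotorsion extends this map to all of
  \<open>P\<close>. Both further groups of the exact sequence consist of cosets in \<open>P\<close>,
  whence the type \<open>'p set\<close>.\<close>

lemma cotorsion_image_of_isolated_overgroup:
  fixes A :: "'a monoid" and P :: "'p monoid"
  assumes cot: "cotorsion TYPE('p set) TYPE('p set) A"
    and P: "comm_group P" and L: "comm_group L"
    and \<phi>: "\<phi> \<in> epi L A" and \<iota>: "\<iota> \<in> hom L P" and T: "subgroup T P"
    and ker: "\<And>f. f \<in> carrier L \<Longrightarrow> \<iota> f \<in> T \<Longrightarrow> \<phi> f = \<one>\<^bsub>A\<^esub>"
    and pure: "monoid.isolated P (T <#>\<^bsub>P\<^esub> \<iota> ` carrier L)"
  obtains g where "g \<in> epi P A" "\<And>t. t \<in> T \<Longrightarrow> g t = \<one>\<^bsub>A\<^esub>"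
proof -
  interpret A: comm_group A using cot by (simp add: cotorsion_def)
  interpret P: comm_group P by fact
  interpret L: comm_group L by fact
  interpret \<phi>: group_hom L A \<phi> by unfold_locales (use \<phi> in \<open>simp add: epi_def\<close>)
  interpret \<iota>: group_hom L P \<iota> by unfold_locales (rule \<iota>)
  interpret T: subgroup T P by fact
  have \<phi>_surj: "\<phi> ` carrier L = carrier A" using \<phi> by (simp add: epi_def)
  \<comment> \<open>\<open>N'\<close> is the domain of the map to be extended and \<open>N\<close>
    its kernel, so \<open>A\<close> is isomorphic to \<open>N' / N\<close> inside
    \<open>P / N\<close>, with torsion-free quotient \<open>P / N'\<close>.\<close>
  define N where "N = T <#>\<^bsub>P\<^esub> \<iota> ` kernel L A \<phi>"
  define N' where "N' = T <#>\<^bsub>P\<^esub> \<iota> ` carrier L"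
  have N: "subgroup N P" unfolding N_def
    by (rule P.mult_subgroups[OF T \<iota>.subgroup_img_is_subgroup[OF \<phi>.subgroup_kernel]])
  have N': "subgroup N' P" unfolding N'_def
    by (rule P.mult_subgroups[OF T \<iota>.img_is_subgroup])
  have NN': "N \<subseteq> N'" unfolding N_def N'_def set_mult_def kernel_def by blast
  have \<iota>N: "\<iota> f \<in> N" if "f \<in> kernel L A \<phi>" for f
  proof -
    have "\<iota> f = \<one>\<^bsub>P\<^esub> \<otimes>\<^bsub>P\<^esub> \<iota> f" using that by (simp add: kernel_def)
    then show ?thesis unfolding N_def set_mult_def using that T.one_closed by blast
  qed
  have \<iota>N': "\<iota> f \<in> N'" if "f \<in> carrier L" for f
  proof -
    have "\<iota> f = \<one>\<^bsub>P\<^esub> \<otimes>\<^bsub>P\<^esub> \<iota> f" using that by simp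
    then show ?thesis unfolding N'_def set_mult_def using that T.one_closed by blast
  qed
  have TN: "t \<in> N" if "t \<in> T" for t
  proof -
    have "t = t \<otimes>\<^bsub>P\<^esub> \<iota> \<one>\<^bsub>L\<^esub>" using that T.mem_carrier by simp
    moreover have "\<one>\<^bsub>L\<^esub> \<in> kernel L A \<phi>" by (simp add: kernel_def)
    ultimately show ?thesis unfolding N_def set_mult_def using that by blast
  qed
  interpret N: normal N P using N P.subgroup_imp_normal by blast
  interpret N': normal N' P using N' P.subgroup_imp_normal by blast
  let ?B = "P Mod N" and ?C = "P Mod N'"
  interpret B: comm_group ?B using P.abelian_FactGroup[OF N] .
  interpret C: comm_group ?C using P.abelian_FactGroup[OF N'] .
  have Bc: "N #>\<^bsub>P\<^esub> x \<in> carrier ?B" "N' #>\<^bsub>P\<^esub> x \<in> carrier ?C" if "x \<in> carrier P" for x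
    using that by (auto simp: carrier_FactGroup)
  obtain p where p: "p \<in> hom ?B ?C" and pN: "\<And>x. x \<in> carrier P \<Longrightarrow> p (N #>\<^bsub>P\<^esub> x) = N' #>\<^bsub>P\<^esub> x"
  proof (rule FactGroup_universal[OF N'.r_coset_hom_Mod N.normal_axioms])
    show "N' #>\<^bsub>P\<^esub> x = N' #>\<^bsub>P\<^esub> y"
      if "x \<in> carrier P" "y \<in> carrier P" "N #>\<^bsub>P\<^esub> x = N #>\<^bsub>P\<^esub> y" for x y
      using that P.rcos_eq_iff[OF N] P.rcos_eq_iff[OF N'] NN' by blast
  qed blast
  interpret p: group_hom ?B ?C p by unfold_locales (rule p)
  \<comment> \<open>\<open>\<psi>\<close> induces, via \<open>\<phi>\<close>, an embedding of \<open>A\<close> into \<open>P / N\<close>.\<close>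
  define \<psi> where "\<psi> f = N #>\<^bsub>P\<^esub> \<iota> f" for f
  have \<psi>: "\<psi> \<in> hom L ?B"
    unfolding \<psi>_def using hom_compose[OF \<iota> N.r_coset_hom_Mod] by (simp add: comp_def)
  interpret \<psi>: group_hom L ?B \<psi> by unfold_locales (rule \<psi>)
  have \<psi>_one: "\<psi> f = \<one>\<^bsub>?B\<^esub> \<longleftrightarrow> \<phi> f = \<one>\<^bsub>A\<^esub>" if f: "f \<in> carrier L" for f
  proof
    assume "\<phi> f = \<one>\<^bsub>A\<^esub>"
    then have "\<iota> f \<in> N" using f \<iota>N by (simp add: kernel_def)
    then show "\<psi> f = \<one>\<^bsub>?B\<^esub>" unfolding \<psi>_def using P.rcos_eq_self_iff[OF N] f by simp
  next
    assume "\<psi> f = \<one>\<^bsub>?B\<^esub>"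
    then have "\<iota> f \<in> N" unfolding \<psi>_def using P.rcos_eq_self_iff[OF N] f by simp
    then obtain t k where t: "t \<in> T" and k: "k \<in> carrier L" "\<phi> k = \<one>\<^bsub>A\<^esub>" and eq: "\<iota> f = t \<otimes>\<^bsub>P\<^esub> \<iota> k"
      unfolding N_def set_mult_def kernel_def by blast
    \<comment> \<open>Comparing the two expressions moves the ambiguity into \<open>T\<close>, where
      \<open>ker\<close> controls it.\<close>
    have "\<iota> (f \<otimes>\<^bsub>L\<^esub> inv\<^bsub>L\<^esub> k) = t" using f k t eq T.mem_carrier by (simp add: P.m_assoc)
    then have "\<phi> (f \<otimes>\<^bsub>L\<^esub> inv\<^bsub>L\<^esub> k) = \<one>\<^bsub>A\<^esub>" using ker t f k by simp
    then show "\<phi> f = \<one>\<^bsub>A\<^esub>" using f k by simp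
  qed
  have \<psi>_eq: "\<psi> f = \<psi> f'" if f: "f \<in> carrier L" "f' \<in> carrier L" "\<phi> f = \<phi> f'" for f f'
  proof -
    have "\<psi> (f \<otimes>\<^bsub>L\<^esub> inv\<^bsub>L\<^esub> f') = \<one>\<^bsub>?B\<^esub>" by (rule iffD2[OF \<psi>_one]) (use f in simp_all)
    then have "\<psi> f \<otimes>\<^bsub>?B\<^esub> inv\<^bsub>?B\<^esub> \<psi> f' = \<one>\<^bsub>?B\<^esub>" using f by (simp only: \<psi>.hom_mult \<psi>.hom_inv L.inv_closed)
    then show ?thesis
      using B.inv_equality[of "\<psi> f" "inv\<^bsub>?B\<^esub> \<psi> f'"] \<psi>.hom_closed f B.inv_inv B.inv_closed by metis
  qed
  have "\<forall>a\<in>carrier A. \<exists>f. f \<in> carrier L \<and> \<phi> f = a" unfolding \<phi>_surj[symmetric] by blast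
  then obtain l where l: "\<And>a. a \<in> carrier A \<Longrightarrow> l a \<in> carrier L" "\<And>a. a \<in> carrier A \<Longrightarrow> \<phi> (l a) = a"
    by metis
  define i where "i a = \<psi> (l a)" for a
  have i\<phi>: "i (\<phi> f) = \<psi> f" if "f \<in> carrier L" for f
    unfolding i_def using that l by (intro \<psi>_eq) auto
  have i: "i \<in> hom A ?B"
  proof (rule homI)
    fix a b assume ab: "a \<in> carrier A" "b \<in> carrier A"
    have "i (a \<otimes>\<^bsub>A\<^esub> b) = \<psi> (l a \<otimes>\<^bsub>L\<^esub> l b)"
      unfolding i_def using ab l by (intro \<psi>_eq) auto
    then show "i (a \<otimes>\<^bsub>A\<^esub> b) = i a \<otimes>\<^bsub>?B\<^esub> i b"
      unfolding i_def using \<psi>.hom_mult l(1) ab by metis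
  qed (use l in \<open>simp add: i_def del: carrier_FactGroup\<close>)
  interpret i: group_hom A ?B i by unfold_locales (rule i)
  have i_mon: "i \<in> mon A ?B"
    using mon_iff_hom_one[OF A.is_group B.is_group] i l \<psi>_one unfolding i_def by metis
  then have i_inj: "inj_on i (carrier A)" by (simp add: mon_def)
  have p_epi: "p \<in> epi ?B ?C"
  proof -
    have "p ` carrier ?B = carrier ?C" unfolding carrier_FactGroup using pN by (force simp: image_image)
    then show ?thesis using p by (simp add: epi_def)
  qed
  have exact: "i ` carrier A = kernel ?B ?C p"
  proof
    show "i ` carrier A \<subseteq> kernel ?B ?C p"
    proof
      fix X assume "X \<in> i ` carrier A"
      then obtain a where a: "a \<in> carrier A" "X = i a" by blast
      have "p (i a) = N' #>\<^bsub>P\<^esub> \<iota> (l a)" unfolding i_def \<psi>_def using pN a l by simp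
      also have "\<dots> = \<one>\<^bsub>?C\<^esub>" using P.rcos_eq_self_iff[OF N'] \<iota>N' l a by simp
      finally show "X \<in> kernel ?B ?C p" using a i.hom_closed unfolding kernel_def by simp
    qed
    show "kernel ?B ?C p \<subseteq> i ` carrier A"
    proof
      fix X assume X: "X \<in> kernel ?B ?C p"
      then obtain x where x: "x \<in> carrier P" "X = N #>\<^bsub>P\<^esub> x" unfolding kernel_def carrier_FactGroup by blast
      then have "N' #>\<^bsub>P\<^esub> x = N'" using X pN by (simp add: kernel_def)
      then have "x \<in> N'" using P.rcos_eq_self_iff[OF N'] x by simp
      then obtain t f where t: "t \<in> T" and f: "f \<in> carrier L" and eq: "x = t \<otimes>\<^bsub>P\<^esub> \<iota> f"
        unfolding N'_def set_mult_def by blast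
      have "x \<otimes>\<^bsub>P\<^esub> inv\<^bsub>P\<^esub> \<iota> f = t" using eq t f T.mem_carrier by (simp add: P.m_assoc)
      then have "N #>\<^bsub>P\<^esub> x = N #>\<^bsub>P\<^esub> \<iota> f" using P.rcos_eq_iff[OF N] x(1) f TN[OF t] by simp
      then have "X = i (\<phi> f)" using i\<phi>[OF f] x(2) \<psi>_def by simp
      then show "X \<in> i ` carrier A" by (rule image_eqI) (rule \<phi>.hom_closed[OF f])
    qed
  qed
  have "torsion_free_group ?C" using P.torsion_free_Mod_iff[OF N'] pure N'_def by simp
  then have "splits ?B p ?C"
    using cot B.comm_group_axioms C.comm_group_axioms i_mon p_epi exact
    unfolding cotorsion_def short_exact_def by blast
  then obtain s where s: "s \<in> hom ?C ?B" "\<And>c. c \<in> carrier ?C \<Longrightarrow> p (s c) = c"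
    unfolding splits_def by blast
  interpret s: group_hom ?C ?B s by unfold_locales (rule s)
  \<comment> \<open>The splitting \<open>s\<close> gives the projection \<open>r\<close> of
    \<open>P / N\<close> onto the embedded copy of \<open>A\<close>; \<open>g\<close> is its
    composite with the quotient map, read in \<open>A\<close>.\<close>
  define r where "r b = b \<otimes>\<^bsub>?B\<^esub> inv\<^bsub>?B\<^esub> s (p b)" for b
  have r_hom: "r (x \<otimes>\<^bsub>?B\<^esub> y) = r x \<otimes>\<^bsub>?B\<^esub> r y" if "x \<in> carrier ?B" "y \<in> carrier ?B" for x y
    unfolding r_def using that by (simp add: B.inv_mult B.m_ac del: mult_FactGroup)
  have r_ker: "r b \<in> kernel ?B ?C p" if "b \<in> carrier ?B" for b
    unfolding r_def kernel_def using that s(2) by (simp del: mult_FactGroup one_FactGroup)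
  have "\<exists>a. a \<in> carrier A \<and> i a = r (N #>\<^bsub>P\<^esub> x)" if x: "x \<in> carrier P" for x
    using r_ker[OF Bc(1)[OF x]] unfolding exact[symmetric] by force
  then obtain g where g: "\<And>x. x \<in> carrier P \<Longrightarrow> g x \<in> carrier A"
    "\<And>x. x \<in> carrier P \<Longrightarrow> i (g x) = r (N #>\<^bsub>P\<^esub> x)" by metis
  have g_hom: "g \<in> hom P A"
  proof (rule homI)
    fix x y assume xy: "x \<in> carrier P" "y \<in> carrier P"
    have "i (g (x \<otimes>\<^bsub>P\<^esub> y)) = r ((N #>\<^bsub>P\<^esub> x) \<otimes>\<^bsub>?B\<^esub> (N #>\<^bsub>P\<^esub> y))"
      using xy g by (simp add: N.rcos_sum)
    also have "\<dots> = i (g x \<otimes>\<^bsub>A\<^esub> g y)"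
      using xy g Bc by (simp add: r_hom del: mult_FactGroup)
    finally show "g (x \<otimes>\<^bsub>P\<^esub> y) = g x \<otimes>\<^bsub>A\<^esub> g y"
      using inj_onD[OF i_inj] g(1) xy by simp
  qed (rule g)
  \<comment> \<open>On cosets of elements of \<open>N'\<close> the map \<open>p\<close> is trivial,
    so \<open>r\<close> fixes them.\<close>
  have gI: "g x = a" if x: "x \<in> carrier P" "x \<in> N'" "N #>\<^bsub>P\<^esub> x = i a" "a \<in> carrier A" for x a
  proof -
    have "p (N #>\<^bsub>P\<^esub> x) = \<one>\<^bsub>?C\<^esub>" using pN[OF x(1)] P.rcos_eq_self_iff[OF N' x(1)] x(2) by simp
    then have "i (g x) = i a"
      using g(2)[OF x(1)] x(3,4) unfolding r_def by (simp del: mult_FactGroup one_FactGroup)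
    then show ?thesis using inj_onD[OF i_inj] g(1) x by simp
  qed
  show thesis
  proof (rule that)
    have "carrier A \<subseteq> g ` carrier P"
    proof
      fix a assume a: "a \<in> carrier A"
      have "g (\<iota> (l a)) = a"
        by (rule gI) (use a l \<iota>N' in \<open>auto simp: i_def \<psi>_def\<close>)
      then show "a \<in> g ` carrier P" using a l(1) \<iota>.hom_closed by (metis image_eqI)
    qed
    moreover have "g ` carrier P \<subseteq> carrier A" using g(1) by (rule image_subsetI)
    ultimately show "g \<in> epi P A" using g_hom by (simp add: epi_def subset_antisym)
    show "g t = \<one>\<^bsub>A\<^esub>" if t: "t \<in> T" for t
    proof (rule gI)
      show "N #>\<^bsub>P\<^esub> t = i \<one>\<^bsub>A\<^esub>"
        using P.rcos_eq_self_iff[OF N] T.mem_carrier TN t by simp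
    qed (use t TN NN' T.mem_carrier in auto)
  qed
qed

section \<open>Free abelian groups inside products of cyclic groups\<close>

text \<open>Each \<open>a\<close> of \<open>S\<close> gets one factor of every positive order. The
  successor excludes modulus 0, which would give the infinite cyclic group.\<close>

definition cyclic_power :: "'a set \<Rightarrow> ('a \<times> nat \<Rightarrow> int) monoid" where
  "cyclic_power S = product_group (S \<times> UNIV) (\<lambda>j. integer_mod_group (Suc (snd j)))"

lemma comm_group_product_group:
  assumes "\<And>i. i \<in> I \<Longrightarrow> comm_group (G i)"
  shows "comm_group (product_group I G)"
proof (rule group.group_comm_groupI)
  show "group (product_group I G)" using assms by (simp add: comm_group.axioms)
  fix x y assume "x \<in> carrier (product_group I G)" "y \<in> carrier (product_group I G)"
  then show "x \<otimes>\<^bsub>product_group I G\<^esub> y = y \<otimes>\<^bsub>product_group I G\<^esub> x"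
    using assms by (auto intro!: restrict_ext simp: comm_monoid.m_comm[OF comm_group.axioms(1)] PiE_iff)
qed

lemma comm_group_cyclic_power: "comm_group (cyclic_power S)"
  unfolding cyclic_power_def by (rule comm_group_product_group) simp

lemma carrier_cyclic_power:
  "carrier (cyclic_power S) = (\<Pi>\<^sub>E j\<in>S \<times> UNIV. {0..<int (Suc (snd j))})"
  by (simp add: cyclic_power_def carrier_integer_mod_group)

lemma one_cyclic_power: "\<one>\<^bsub>cyclic_power S\<^esub> = (\<lambda>j\<in>S \<times> UNIV. 0)"
  by (simp add: cyclic_power_def)

lemma mult_cyclic_power:
  "x \<otimes>\<^bsub>cyclic_power S\<^esub> y = (\<lambda>j\<in>S \<times> UNIV. (x j + y j) mod int (Suc (snd j)))"
  by (simp add: cyclic_power_def)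

lemma int_pow_cyclic_power:
  assumes "x \<in> carrier (cyclic_power S)"
  shows "x [^]\<^bsub>cyclic_power S\<^esub> (k::int) = (\<lambda>j\<in>S \<times> UNIV. k * x j mod int (Suc (snd j)))"
proof -
  interpret comm_group "cyclic_power S" by (rule comm_group_cyclic_power)
  have "x [^]\<^bsub>cyclic_power S\<^esub> k \<in> extensional (S \<times> UNIV)"
    using int_pow_closed[OF assms] unfolding carrier_cyclic_power PiE_def by blast
  moreover have "(x [^]\<^bsub>cyclic_power S\<^esub> k) j = k * x j mod int (Suc (snd j))" if "j \<in> S \<times> UNIV" for j
    using int_pow_product_group[of "S \<times> UNIV" "\<lambda>j. integer_mod_group (Suc (snd j))" x j k] assms that
    by (simp add: cyclic_power_def int_pow_integer_mod_group)
  ultimately show ?thesis by (auto simp: fun_eq_iff extensional_def)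
qed

definition torsion_subset :: "('a, 'm) monoid_scheme \<Rightarrow> 'a set" where
  "torsion_subset G = {x \<in> carrier G. \<exists>n::nat. n > 0 \<and> x [^]\<^bsub>G\<^esub> n = \<one>\<^bsub>G\<^esub>}"

lemma (in comm_group) subgroup_torsion_subset: "subgroup (torsion_subset G) G"
proof
  show "torsion_subset G \<subseteq> carrier G" by (auto simp: torsion_subset_def)
  show "\<one> \<in> torsion_subset G" by (auto simp: torsion_subset_def intro!: exI[of _ 1])
  show "x \<otimes> y \<in> torsion_subset G" if xy: "x \<in> torsion_subset G" "y \<in> torsion_subset G" for x y
  proof -
    obtain m n :: nat where *: "m > 0" "n > 0" "x [^] m = \<one>" "y [^] n = \<one>"
      and c: "x \<in> carrier G" "y \<in> carrier G" using xy by (auto simp: torsion_subset_def)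
    have "x [^] (m * n) = \<one>" "y [^] (n * m) = \<one>"
      using * c by (metis nat_pow_one nat_pow_pow)+
    then have "(x \<otimes> y) [^] (m * n) = \<one>" using c by (simp add: nat_pow_distrib mult.commute)
    moreover have "m * n > 0" using * by simp
    ultimately show ?thesis using c unfolding torsion_subset_def by blast
  qed
  show "inv x \<in> torsion_subset G" if "x \<in> torsion_subset G" for x
    using that by (auto simp: torsion_subset_def nat_pow_inv)
qed

text \<open>The coefficient of \<open>f\<close> at \<open>a\<close> is reduced modulo every positive
  integer. Large moduli detect that an integer is nonzero, and the modulus \<open>n * m\<close>
  detects divisibility by \<open>n\<close>; the former separates the image from torsion, the latter
  allows \<open>n\<close>-th roots to be taken in the free group.\<close>

lemma free_Abelian_group_in_cyclic_power:
  fixes S :: "'a set"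
  defines "\<iota> \<equiv> \<lambda>f::'a \<Rightarrow>\<^sub>0 int. \<lambda>j\<in>S \<times> UNIV. Poly_Mapping.lookup f (fst j) mod int (Suc (snd j))"
  shows "\<iota> \<in> hom (free_Abelian_group S) (cyclic_power S)"
    and "\<And>f. f \<in> carrier (free_Abelian_group S) \<Longrightarrow> \<iota> f \<in> torsion_subset (cyclic_power S) \<Longrightarrow> f = 0"
    and "monoid.isolated (cyclic_power S)
      (torsion_subset (cyclic_power S) <#>\<^bsub>cyclic_power S\<^esub> \<iota> ` carrier (free_Abelian_group S))"
proof -
  let ?P = "cyclic_power S" and ?L = "free_Abelian_group S" and ?T = "torsion_subset (cyclic_power S)"
  interpret P: comm_group ?P by (rule comm_group_cyclic_power)
  have c: "\<iota> f \<in> carrier ?P" for f unfolding \<iota>_def carrier_cyclic_power by auto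
  show hom: "\<iota> \<in> hom ?L ?P"
    by (rule homI) (use c in \<open>auto simp: \<iota>_def mult_cyclic_power lookup_add mod_add_eq intro!: restrict_ext\<close>)
  interpret \<iota>: group_hom ?L ?P \<iota>
    by (intro group_hom.intro group_hom_axioms.intro group_free_Abelian_group P.is_group hom)
  have pow: "\<iota> f [^]\<^bsub>?P\<^esub> (k::int) = (\<lambda>j\<in>S \<times> UNIV. k * Poly_Mapping.lookup f (fst j) mod int (Suc (snd j)))" for f k
    unfolding int_pow_cyclic_power[OF c] by (rule restrict_ext) (auto simp: \<iota>_def mod_mult_right_eq)
  have supp: "Poly_Mapping.lookup f a = 0" if "f \<in> carrier ?L" "a \<notin> S" for f a
    using that by (auto simp: in_keys_iff)
  show "f = 0" if f: "f \<in> carrier ?L" "\<iota> f \<in> ?T" for f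
  proof (rule poly_mapping_eqI)
    fix a
    obtain m :: nat where m: "m > 0" "\<iota> f [^]\<^bsub>?P\<^esub> m = \<one>\<^bsub>?P\<^esub>" using f by (auto simp: torsion_subset_def)
    let ?l = "int m * Poly_Mapping.lookup f a"
    have "Poly_Mapping.lookup f a = 0" if a: "a \<in> S"
    proof -
      \<comment> \<open>The index is chosen so that the modulus \<open>1 + \<bar>?l\<bar>\<close>
        exceeds the absolute value of \<open>?l\<close>.\<close>
      have "(\<iota> f [^]\<^bsub>?P\<^esub> int m) (a, nat \<bar>?l\<bar>) = 0"
        using a by (simp only: int_pow_int m(2)) (simp add: one_cyclic_power)
      then have "(1 + \<bar>?l\<bar>) dvd ?l" using a unfolding pow by (simp add: dvd_eq_mod_eq_0)
      then have "?l = 0" using zdvd_imp_le[of "1 + \<bar>?l\<bar>" "\<bar>?l\<bar>"] by force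
      then show ?thesis using m(1) by simp
    qed
    then show "Poly_Mapping.lookup f a = Poly_Mapping.lookup 0 a" using supp[OF f(1)] by (cases "a \<in> S") auto
  qed
  show "monoid.isolated ?P (?T <#>\<^bsub>?P\<^esub> \<iota> ` carrier ?L)"
    unfolding P.isolated_def
  proof (intro ballI allI impI)
    fix y and n :: nat
    assume y: "y \<in> carrier ?P" and n: "n > 0" and "y [^]\<^bsub>?P\<^esub> n \<in> ?T <#>\<^bsub>?P\<^esub> \<iota> ` carrier ?L"
    then obtain t f where t: "t \<in> ?T" and f: "f \<in> carrier ?L" and eq: "y [^]\<^bsub>?P\<^esub> n = t \<otimes>\<^bsub>?P\<^esub> \<iota> f"
      unfolding set_mult_def by blast
    obtain m :: nat where m: "m > 0" "t [^]\<^bsub>?P\<^esub> m = \<one>\<^bsub>?P\<^esub>" and tc: "t \<in> carrier ?P"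
      using t by (auto simp: torsion_subset_def)
    have "y [^]\<^bsub>?P\<^esub> (n * m) = (t \<otimes>\<^bsub>?P\<^esub> \<iota> f) [^]\<^bsub>?P\<^esub> m"
      using P.nat_pow_pow[OF y] eq by metis
    also have "\<dots> = \<iota> f [^]\<^bsub>?P\<^esub> m" using tc c m(2) by (simp add: P.nat_pow_distrib)
    finally have ynm: "y [^]\<^bsub>?P\<^esub> int (n * m) = \<iota> f [^]\<^bsub>?P\<^esub> int m" unfolding int_pow_int .
    have eq': "int (n * m) * y j mod int (Suc (snd j)) =
        int m * Poly_Mapping.lookup f (fst j) mod int (Suc (snd j))" if "j \<in> S \<times> UNIV" for j
      using fun_cong[OF ynm, of j] that unfolding pow int_pow_cyclic_power[OF y] by simp
    have dvd: "int n dvd Poly_Mapping.lookup f a" for a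
    proof (cases "a \<in> S")
      case True
      \<comment> \<open>The factor of the product at this index has order \<open>n * m\<close>.\<close>
      have "Suc (n * m - 1) = n * m" using n m(1) by simp
      then have "0 = int m * Poly_Mapping.lookup f a mod int (n * m)"
        using eq'[of "(a, n * m - 1)"] True by (simp only: fst_conv snd_conv) simp
      then have "int m * int n dvd int m * Poly_Mapping.lookup f a"
        by (simp add: dvd_eq_mod_eq_0 mult.commute)
      then show ?thesis using m(1) by simp
    qed (use supp[OF f] in simp)
    \<comment> \<open>All coefficients of \<open>f\<close> are divisible by \<open>n\<close>, so
      \<open>\<iota> f'\<close> is an \<open>n\<close>-th root of \<open>\<iota> f\<close>, and
      \<open>y\<close> differs from it by an element \<open>z\<close> with \<open>n\<close>-th power
      \<open>t\<close>, hence by torsion.\<close>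
    define f' where "f' = Poly_Mapping.map (\<lambda>x. x div int n) f"
    have f'_lookup: "int n * Poly_Mapping.lookup f' a = Poly_Mapping.lookup f a" for a
      using dvd[of a] by (auto simp: f'_def map.rep_eq when_def)
    have "Poly_Mapping.keys f' \<subseteq> Poly_Mapping.keys f"
      by (auto simp: in_keys_iff simp flip: f'_lookup intro!: n)
    then have f': "f' \<in> carrier ?L" using f by (simp add: subset_trans)
    have "\<iota> f' [^]\<^bsub>?P\<^esub> int n = \<iota> f" unfolding pow f'_lookup by (simp add: \<iota>_def)
    then have f'n: "\<iota> f' [^]\<^bsub>?P\<^esub> n = \<iota> f" unfolding int_pow_int .
    define z where "z = y \<otimes>\<^bsub>?P\<^esub> inv\<^bsub>?P\<^esub> \<iota> f'"
    have zc: "z \<in> carrier ?P" unfolding z_def using y c by simp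
    have "z [^]\<^bsub>?P\<^esub> n = t"
      using y c tc unfolding z_def by (simp add: P.nat_pow_distrib P.nat_pow_inv f'n eq P.m_assoc)
    then have "z [^]\<^bsub>?P\<^esub> (n * m) = \<one>\<^bsub>?P\<^esub>" using P.nat_pow_pow[OF zc] m(2) by metis
    moreover have "n * m > 0" using n m(1) by simp
    ultimately have "z \<in> ?T" unfolding torsion_subset_def using zc by blast
    moreover have "y = z \<otimes>\<^bsub>?P\<^esub> \<iota> f'" unfolding z_def using y c by (simp add: P.m_assoc)
    ultimately show "y \<in> ?T <#>\<^bsub>?P\<^esub> \<iota> ` carrier ?L" unfolding set_mult_def using f' by blast
  qed
qed

text \<open>The presentation of \<open>A\<close> is the free abelian group on its own carrier, and
  \<open>T\<close> is the whole torsion subgroup. That \<open>g\<close> kills torsion is what later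
  lets it pass to a reduced product.\<close>

lemma cotorsion_image_of_cyclic_power:
  assumes "cotorsion TYPE('a ext) TYPE('a ext) (A :: 'a monoid)"
  obtains g where "g \<in> epi (cyclic_power (carrier A)) A"
    "\<And>t. t \<in> torsion_subset (cyclic_power (carrier A)) \<Longrightarrow> g t = \<one>\<^bsub>A\<^esub>"
proof -
  interpret A: comm_group A using assms by (simp add: cotorsion_def)
  let ?P = "cyclic_power (carrier A)" and ?L = "free_Abelian_group (carrier A)"
  interpret P: comm_group ?P by (rule comm_group_cyclic_power)
  obtain \<phi> where \<phi>: "\<phi> \<in> hom ?L A" "\<And>a. a \<in> carrier A \<Longrightarrow> \<phi> (frag_of a) = a"
    by (rule A.free_Abelian_group_universal[of "\<lambda>a. a" "carrier A"]) auto
  interpret \<phi>: group_hom ?L A \<phi>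
    by (intro group_hom.intro group_hom_axioms.intro group_free_Abelian_group A.is_group \<phi>(1))
  have "carrier A \<subseteq> \<phi> ` carrier ?L"
    using \<phi>(2) frag_of_in_free_Abelian_group by (metis image_eqI subsetI)
  then have epi: "\<phi> \<in> epi ?L A" using \<phi>(1) \<phi>.hom_closed unfolding epi_def by blast
  note pure = free_Abelian_group_in_cyclic_power[where S = "carrier A"]
  show thesis
  proof (rule cotorsion_image_of_isolated_overgroup[OF assms P.comm_group_axioms abelian_free_Abelian_group epi pure(1)
        P.subgroup_torsion_subset _ pure(3)])
    show "\<phi> f = \<one>\<^bsub>A\<^esub>" if "f \<in> carrier ?L"
      "(\<lambda>j\<in>carrier A \<times> UNIV. Poly_Mapping.lookup f (fst j) mod int (Suc (snd j))) \<in> torsion_subset ?P" for f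
      using pure(2)[OF that] \<phi>.hom_one by simp
  qed (rule that)
qed

lemma finite_cyclic_integer_mod_group:
  "finite (carrier (integer_mod_group (Suc n)))" "cyclic_group (integer_mod_group (Suc n))"
proof -
  let ?Z = "integer_mod_group (Suc n)"
  show "finite (carrier ?Z)" by (simp add: carrier_integer_mod_group)
  \<comment> \<open>The generator is reduced because for \<open>n = 0\<close> the number 1 is not in
    the carrier.\<close>
  let ?f = "\<lambda>k::int. (1 mod int (Suc n)) [^]\<^bsub>?Z\<^esub> k"
  have f: "?f k = k mod int (Suc n)" for k
    unfolding int_pow_integer_mod_group by (simp add: mod_mult_right_eq)
  have "x = ?f x" if "x \<in> carrier ?Z" for x
    using that unfolding f carrier_integer_mod_group by simp
  moreover have "?f k \<in> carrier ?Z" for k unfolding f carrier_integer_mod_group by simp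
  ultimately have "carrier ?Z = range ?f" by blast
  moreover have "1 mod int (Suc n) \<in> carrier ?Z" by (simp add: carrier_integer_mod_group)
  ultimately show "cyclic_group ?Z" using group.cyclic_group[OF group_integer_mod_group] by blast
qed

lemma cotorsion_imp_image_of_product_of_finite_cyclic_groups:
  assumes "cotorsion TYPE('a ext) TYPE('a ext) (A :: 'a monoid)"
  shows "image_of_product_of_finite_cyclic_groups TYPE('a \<times> nat) TYPE(int) A"
proof -
  obtain g where "g \<in> epi (cyclic_power (carrier A)) A"
    by (rule cotorsion_image_of_cyclic_power[OF assms])
  then have "homomorphic_image (product_group (carrier A \<times> UNIV) (\<lambda>j. integer_mod_group (Suc (snd j)))) A"
    unfolding homomorphic_image_def cyclic_power_def by blast
  then show ?thesis
    unfolding image_of_product_of_finite_cyclic_groups_def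
    by (intro exI[of _ "carrier A \<times> UNIV"] exI[of _ "\<lambda>j. integer_mod_group (Suc (snd j))"])
      (simp add: finite_cyclic_integer_mod_group)
qed

text \<open>Regroup the factors by \<open>n\<close>: each \<open>G n\<close> is a power of one
  cyclic group, so a family trivial for almost all \<open>n\<close> has bounded exponent. It is
  therefore torsion and killed by \<open>g\<close>.\<close>

lemma cotorsion_imp_image_of_reduced_product:
  assumes "cotorsion TYPE('a ext) TYPE('a ext) (A :: 'a monoid)"
  shows "image_of_reduced_product TYPE('a \<Rightarrow> int) A"
proof -
  interpret A: comm_group A using assms by (simp add: cotorsion_def)
  let ?P = "cyclic_power (carrier A)"
  interpret P: comm_group ?P by (rule comm_group_cyclic_power)
  obtain g where g: "g \<in> epi ?P A" "\<And>t. t \<in> torsion_subset ?P \<Longrightarrow> g t = \<one>\<^bsub>A\<^esub>"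
    by (rule cotorsion_image_of_cyclic_power[OF assms]) blast
  interpret g: group_hom ?P A g by unfold_locales (use g in \<open>simp add: epi_def\<close>)
  define G where "G n = product_group (carrier A) (\<lambda>_. integer_mod_group (Suc n))" for n
  have G: "group (G n)" for n by (simp add: G_def)
  let ?Q = "product_group UNIV G" and ?N = "carrier (sum_group UNIV G)"
  interpret Q: group ?Q using G by simp
  interpret N: normal ?N ?Q by (rule sum_group_normal) (rule G)
  define \<theta> where "\<theta> x = (\<lambda>j\<in>carrier A \<times> UNIV. x (snd j) (fst j))" for x :: "nat \<Rightarrow> 'a \<Rightarrow> int"
  have Qc: "carrier ?Q = {x. \<forall>n. x n \<in> (\<Pi>\<^sub>E a\<in>carrier A. {0..<int (Suc n)})}"
    by (auto simp: G_def carrier_integer_mod_group PiE_UNIV_domain)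
  have \<theta>c: "\<theta> x \<in> carrier ?P" if "x \<in> carrier ?Q" for x
    using that unfolding Qc carrier_cyclic_power \<theta>_def by (auto simp: PiE_iff)
  have \<theta>: "\<theta> \<in> hom ?Q ?P"
    by (rule homI) (use \<theta>c in \<open>auto simp: \<theta>_def G_def mult_cyclic_power intro!: restrict_ext\<close>)
  interpret \<theta>: group_hom ?Q ?P \<theta> by unfold_locales (rule \<theta>)
  have \<theta>N: "g (\<theta> x) = \<one>\<^bsub>A\<^esub>" if x: "x \<in> ?N" for x
  proof (rule g(2))
    have xQ: "x \<in> carrier ?Q" using N.subset x by blast
    have "finite {n. x n \<noteq> \<one>\<^bsub>G n\<^esub>}" using x carrier_sum_group[of UNIV G] G by simp
    then obtain M where M: "\<And>n. x n \<noteq> \<one>\<^bsub>G n\<^esub> \<Longrightarrow> n < M"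
      using finite_nat_set_iff_bounded by auto
    \<comment> \<open>Nontrivial entries occur only for \<open>Suc n \<le> M\<close>, where the
      modulus \<open>Suc n\<close> divides \<open>M!\<close>.\<close>
    have "int (fact M) * x n a mod int (Suc n) = 0" if "a \<in> carrier A" for a n
    proof (cases "x n = \<one>\<^bsub>G n\<^esub>")
      case False
      then have "Suc n dvd fact M" using M by (simp add: dvd_fact Suc_leI)
      then have "int (Suc n) dvd int (fact M) * x n a" by (simp only: dvd_mult2 int_dvd_int_iff)
      then show ?thesis by (simp only: dvd_eq_mod_eq_0)
    qed (use that in \<open>simp add: G_def\<close>)
    then have "\<theta> x [^]\<^bsub>?P\<^esub> int (fact M) = \<one>\<^bsub>?P\<^esub>"
      unfolding int_pow_cyclic_power[OF \<theta>c[OF xQ]] one_cyclic_power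
      by (intro restrict_ext) (auto simp: \<theta>_def)
    then have "\<theta> x [^]\<^bsub>?P\<^esub> (fact M :: nat) = \<one>\<^bsub>?P\<^esub>" unfolding int_pow_int .
    then show "\<theta> x \<in> torsion_subset ?P"
      unfolding torsion_subset_def using \<theta>c[OF xQ] fact_gt_zero by blast
  qed
  have g\<theta>: "g \<circ> \<theta> \<in> hom ?Q A" using hom_compose[OF \<theta> g.homh] .
  then interpret g\<theta>: group_hom ?Q A "g \<circ> \<theta>" by unfold_locales
  obtain f where f: "f \<in> hom (?Q Mod ?N) A" "\<And>x. x \<in> carrier ?Q \<Longrightarrow> f (?N #>\<^bsub>?Q\<^esub> x) = (g \<circ> \<theta>) x"
  proof (rule FactGroup_universal[OF g\<theta> N.normal_axioms])
    fix x y assume xy: "x \<in> carrier ?Q" "y \<in> carrier ?Q" "?N #>\<^bsub>?Q\<^esub> x = ?N #>\<^bsub>?Q\<^esub> y"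
    then have "x \<otimes>\<^bsub>?Q\<^esub> inv\<^bsub>?Q\<^esub> y \<in> ?N"
      using N.rcos_module[OF Q.is_group xy(2,1)] Q.rcos_self[OF xy(1) N.subgroup_axioms] by blast
    then have "(g \<circ> \<theta>) (x \<otimes>\<^bsub>?Q\<^esub> inv\<^bsub>?Q\<^esub> y) = \<one>\<^bsub>A\<^esub>" using \<theta>N by (simp only: comp_apply)
    then have "(g \<circ> \<theta>) x \<otimes>\<^bsub>A\<^esub> inv\<^bsub>A\<^esub> (g \<circ> \<theta>) y = \<one>\<^bsub>A\<^esub>"
      using xy by (simp only: g\<theta>.hom_mult g\<theta>.hom_inv Q.inv_closed)
    then show "(g \<circ> \<theta>) x = (g \<circ> \<theta>) y"
      using A.inv_equality g\<theta>.hom_closed xy(1,2) A.inv_inv A.inv_closed by metis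
  qed blast
  have "carrier A \<subseteq> f ` carrier (?Q Mod ?N)"
  proof
    fix a assume "a \<in> carrier A"
    moreover have "g ` carrier ?P = carrier A" using g(1) by (simp add: epi_def)
    ultimately obtain y where y: "y \<in> carrier ?P" "g y = a" by (metis imageE)
    define x where "x n = (\<lambda>a\<in>carrier A. y (a, n))" for n
    have x: "x \<in> carrier ?Q" unfolding Qc x_def using y(1) by (auto simp: carrier_cyclic_power PiE_iff)
    have "\<theta> x = y"
      using y(1) unfolding \<theta>_def x_def carrier_cyclic_power
      by (auto simp: fun_eq_iff PiE_iff extensional_def)
    then have "f (?N #>\<^bsub>?Q\<^esub> x) = a" using f(2)[OF x] y(2) by simp
    then show "a \<in> f ` carrier (?Q Mod ?N)" using x unfolding carrier_FactGroup by blast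
  qed
  then have "f \<in> epi (reduced_product G) A"
    using f(1) hom_carrier[OF f(1)] by (simp add: epi_def reduced_product_def subset_antisym)
  then have "homomorphic_image (reduced_product G) A" unfolding homomorphic_image_def by blast
  then show ?thesis
    unfolding image_of_reduced_product_def using G by (intro exI[of _ G]) simp
qed

section \<open>From image conditions to solvability, and the equivalences\<close>

lemma image_of_product_of_finite_groups_imp_sequentially_solvable:
  assumes "group A" "image_of_product_of_finite_groups TYPE('j) TYPE('f) A"
  shows "sequentially_solvable A"
proof -
  obtain J :: "'j set" and F :: "'j \<Rightarrow> 'f monoid" and f
    where F: "\<And>j. j \<in> J \<Longrightarrow> group (F j)" "\<And>j. j \<in> J \<Longrightarrow> finite (carrier (F j))"
      and f: "f \<in> epi (product_group J F) A"
    using assms(2) unfolding image_of_product_of_finite_groups_def homomorphic_image_def by blast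
  have "sequentially_solvable (product_group J F)"
    by (intro sequentially_solvable_product_group sequentially_solvable_finite F)
  then show ?thesis
    using sequentially_solvable_epi[OF product_group[OF F(1)] assms(1) f] by simp
qed

lemma image_of_reduced_product_imp_sequentially_solvable:
  assumes "group A" "image_of_reduced_product TYPE('g) A"
  shows "sequentially_solvable A"
proof -
  obtain G :: "nat \<Rightarrow> 'g monoid" and f where G: "\<And>i. group (G i)" and f: "f \<in> epi (reduced_product G) A"
    using assms(2) unfolding image_of_reduced_product_def homomorphic_image_def by blast
  have "group (reduced_product G)"
    unfolding reduced_product_def by (rule normal.factorgroup_is_group[OF sum_group_normal]) (rule G)
  then show ?thesis
    by (rule sequentially_solvable_epi[OF _ assms(1) f sequentially_solvable_reduced_product]) (rule G)
qed

lemma image_of_finite_cyclic_imp_image_of_finite: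
  "image_of_product_of_finite_cyclic_groups TYPE('j) TYPE('f) A \<Longrightarrow>
   image_of_product_of_finite_groups TYPE('j) TYPE('f) A"
  unfolding image_of_product_of_finite_cyclic_groups_def image_of_product_of_finite_groups_def by blast

theorem theorem17:
  fixes A :: "'a monoid"
  assumes "comm_group A"
  shows
    "(cotorsion TYPE('a ext) TYPE('a ext) A
        \<longleftrightarrow> image_of_reduced_product TYPE('a \<Rightarrow> int) A)
     \<and> (cotorsion TYPE('a ext) TYPE('a ext) A
        \<longleftrightarrow> image_of_product_of_finite_cyclic_groups TYPE('a \<times> nat) TYPE(int) A)
     \<and> (cotorsion TYPE('a ext) TYPE('a ext) A
        \<longleftrightarrow> image_of_product_of_finite_groups TYPE('a \<times> nat) TYPE(int) A)
     \<and> (cotorsion TYPE('a ext) TYPE('a ext) A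
        \<longrightarrow> cotorsion TYPE('b) TYPE('c) A)
     \<and> (image_of_reduced_product TYPE('g) A
        \<longrightarrow> image_of_reduced_product TYPE('a \<Rightarrow> int) A)
     \<and> (image_of_product_of_finite_cyclic_groups TYPE('i) TYPE('e) A
        \<longrightarrow> image_of_product_of_finite_cyclic_groups TYPE('a \<times> nat) TYPE(int) A)
     \<and> (image_of_product_of_finite_groups TYPE('j) TYPE('f) A
        \<longrightarrow> image_of_product_of_finite_groups TYPE('a \<times> nat) TYPE(int) A)"
proof -
  have A: "group A" using assms by (rule comm_group.axioms)
  \<comment> \<open>Solvability does not mention the auxiliary types. Changing types therefore means
    passing from any of the conditions to solvability, on to \<open>cotorsion\<close> at
    \<open>'a ext\<close>, and from there to the fixed types.\<close>
  note solvable = sequentially_solvable_imp_cotorsion[OF assms]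
  note reduced = image_of_reduced_product_imp_sequentially_solvable[OF A]
  note finite = image_of_product_of_finite_groups_imp_sequentially_solvable[OF A]
  note cyclic = finite[OF image_of_finite_cyclic_imp_image_of_finite]
  note cot2 = cotorsion_imp_image_of_reduced_product[of A]
  note cot3 = cotorsion_imp_image_of_product_of_finite_cyclic_groups[of A]
  note cot4 = image_of_finite_cyclic_imp_image_of_finite[OF cot3]
  show ?thesis
    apply (intro conjI iffI impI)
             apply (erule cot2)
            apply (erule solvable[OF reduced])
           apply (erule cot3)
          apply (erule solvable[OF cyclic])
         apply (erule cot4)
        apply (erule solvable[OF finite])
       apply (erule solvable[OF cyclic[OF cot3]])
      apply (erule cot2[OF solvable[OF reduced]])
     apply (erule cot3[OF solvable[OF cyclic]])
    apply (erule cot4[OF solvable[OF finite]])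
    done
qed

end
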